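(* For every integer $n\ge1$ and every $c\in\mathbb{Q}$, $\widehat{\partial}_n^{(c)}(\mathcal{A}^0_{\mu_r})\subset\operatorname{Ker}\mathcal{L}^{\mathrm{sh}}$.
   Context: Fix a positive integer $r$; $\mu_r$ is the group of $r$-th roots of unity, $\mathcal{A}_{\mu_r}=\mathbb{Q}\langle x,y_s\mid s\in\mu_r\rangle$, $\mathcal{A}^0_{\mu_r}=\mathbb{Q}+\sum_s x\mathcal{A}_{\mu_r}y_s+\sum_{s,t,\,t\ne1}y_t\mathcal{A}_{\mu_r}y_s$, and $z=x+y_1$. $H$ is the derivation with $H(w)=\deg(w)w$ for words $w$ ($\deg$ = number of letters). $\partial_1$ is the derivation of $\mathcal{A}_{\mu_r}$ with $\partial_1(x)=xy_1$, $\partial_1(y_s)=-xy_s+y_sy_1-y_sy_s$. $\theta$ is the derivation with $\theta(u)=\frac12(uz+zu)$ for $u\in\{x\}\cup\{y_s\}$. For $c\in\mathbb{Q}$, $\widehat\theta^{(c)}$ is the $\mathbb{Q}$-linear map with $\widehat\theta^{(c)}(u)=\theta(u)$ for letters $u$ and $\widehat\theta^{(c)}(ww')=\widehat\theta^{(c)}(w)w'+w\widehat\theta^{(c)}(w')+cH(w)\partial_1(w')$ for all $w,w'$. With $\mathrm{ad}(P)(Q)=PQ-QP$, set $\widehat\partial_n^{(c)}=\frac{1}{(n-1)!}\mathrm{ad}(\widehat\theta^{(c)})^{n-1}(\partial_1)$. $\mathcal{L}^{\mathrm{sh}}:\mathcal{A}^0_{\mu_r}\to\mathbb{C}$ is the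 $\mathbb{Q}$-linear map with $\mathcal{L}^{\mathrm{sh}}(1)=1$ and $\mathcal{L}^{\mathrm{sh}}(x^{k_1-1}y_{s_1}\cdots x^{k_n-1}y_{s_n})=\lim_{M\to\infty}\sum_{M>m_1>\cdots>m_n>0}\frac{s_1^{m_1-m_2}\cdots s_{n-1}^{m_{n-1}-m_n}s_n^{m_n}}{m_1^{k_1}\cdots m_n^{k_n}}$. *)

theory Defs
  imports "HOL-Analysis.Analysis"
begin

text \<open>Letters of the alphabet of A_{mu_r}: X is x, Y j (with j < r) is y_s for the
  root of unity s = exp(2 pi i j / r).  In particular y_1 = Y 0.\<close>

datatype letter = X | Y nat

definition root :: "nat \<Rightarrow> nat \<Rightarrow> complex" where
  "root r j = cis (2 * pi * real j / real r)"

definition valid_letter :: "nat \<Rightarrow> letter \<Rightarrow> bool" where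
  "valid_letter r a = (case a of X \<Rightarrow> True | Y j \<Rightarrow> j < r)"

text \<open>Elements of the free algebra Q<x, y_s> : coefficient functions on words
  (finite support is imposed where needed).\<close>

type_synonym nc = "letter list \<Rightarrow> rat"

definition supp :: "nc \<Rightarrow> letter list set" where
  "supp P = {w. P w \<noteq> 0}"

definition A :: "nat \<Rightarrow> nc set" where
  "A r = {P. finite (supp P) \<and> (\<forall>w \<in> supp P. \<forall>a \<in> set w. valid_letter r a)}"

definition conv_word :: "letter list \<Rightarrow> bool" where
  "conv_word w = (w = [] \<or>
     (length w \<ge> 2 \<and> (\<exists>s. last w = Y s) \<and> (hd w = X \<or> (\<exists>t. hd w = Y t \<and> t \<noteq> 0))))"

text \<open>A^0 = Q + sum_s x A y_s + sum_{t<>1} y_t A y_s  (span of the convergent words).\<close>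
definition A0 :: "nat \<Rightarrow> nc set" where
  "A0 r = {P \<in> A r. \<forall>w \<in> supp P. conv_word w}"

definition wd :: "letter list \<Rightarrow> nc" where
  "wd w = (\<lambda>v. if v = w then 1 else 0)"

definition ncadd :: "nc \<Rightarrow> nc \<Rightarrow> nc" (infixl "\<oplus>" 65) where
  "P \<oplus> Q = (\<lambda>w. P w + Q w)"

definition ncsub :: "nc \<Rightarrow> nc \<Rightarrow> nc" (infixl "\<ominus>" 65) where
  "P \<ominus> Q = (\<lambda>w. P w - Q w)"

definition ncsmult :: "rat \<Rightarrow> nc \<Rightarrow> nc" (infixr "\<cdot>" 75) where
  "c \<cdot> P = (\<lambda>w. c * P w)"

definition ncmult :: "nc \<Rightarrow> nc \<Rightarrow> nc" (infixl "\<otimes>" 70) where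
  "P \<otimes> Q = (\<lambda>w. \<Sum>i\<le>length w. P (take i w) * Q (drop i w))"

definition lin :: "(letter list \<Rightarrow> nc) \<Rightarrow> nc \<Rightarrow> nc" where
  "lin f P = (\<lambda>v. \<Sum>w \<in> supp P. P w * f w v)"

definition der_word :: "(letter \<Rightarrow> nc) \<Rightarrow> letter list \<Rightarrow> nc" where
  "der_word D w = (\<lambda>v. \<Sum>i<length w. ((wd (take i w) \<otimes> D (w ! i)) \<otimes> wd (drop (Suc i) w)) v)"

definition der :: "(letter \<Rightarrow> nc) \<Rightarrow> nc \<Rightarrow> nc" where
  "der D = lin (der_word D)"

definition Hop :: "nc \<Rightarrow> nc" where
  "Hop = lin (\<lambda>w. of_nat (length w) \<cdot> wd w)"

definition z :: nc where
  "z = wd [X] \<oplus> wd [Y 0]"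

definition d1_letter :: "letter \<Rightarrow> nc" where
  "d1_letter a = (case a of X \<Rightarrow> wd [X, Y 0]
     | Y s \<Rightarrow> ((wd [Y s, Y 0] \<ominus> wd [X, Y s]) \<ominus> wd [Y s, Y s]))"

definition d1 :: "nc \<Rightarrow> nc" where
  "d1 = der d1_letter"

definition theta_letter :: "letter \<Rightarrow> nc" where
  "theta_letter a = (1/2) \<cdot> (wd [a] \<otimes> z \<oplus> z \<otimes> wd [a])"

text \<open>thetahat^(c) on words, by peeling off the first letter using the defining rule
  thetahat(w w') = thetahat(w) w' + w thetahat(w') + c H(w) d1(w') with w a letter;
  thetahat(1) = 0 is forced by the rule.\<close>
fun thetahat_word :: "rat \<Rightarrow> letter list \<Rightarrow> nc" where
  "thetahat_word c [] = (\<lambda>_. 0)"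
| "thetahat_word c (a # w) =
     theta_letter a \<otimes> wd w \<oplus> wd [a] \<otimes> thetahat_word c w \<oplus> c \<cdot> (Hop (wd [a]) \<otimes> d1 (wd w))"

definition thetahat :: "rat \<Rightarrow> nc \<Rightarrow> nc" where
  "thetahat c = lin (thetahat_word c)"

definition ad :: "(nc \<Rightarrow> nc) \<Rightarrow> (nc \<Rightarrow> nc) \<Rightarrow> (nc \<Rightarrow> nc)" where
  "ad P Q = (\<lambda>u. P (Q u) \<ominus> Q (P u))"

definition dhat :: "rat \<Rightarrow> nat \<Rightarrow> nc \<Rightarrow> nc" where
  "dhat c n = (\<lambda>u. (1 / of_nat (fact (n - 1))) \<cdot> ((ad (thetahat c) ^^ (n - 1)) d1 u))"

text \<open>Decomposition of a word x^{k_1-1} y_{s_1} ... x^{k_n-1} y_{s_n} into pairs (k_i, j_i).\<close>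
fun blocks :: "letter list \<Rightarrow> (nat \<times> nat) list" where
  "blocks [] = []"
| "blocks (Y j # w) = (1, j) # blocks w"
| "blocks (X # w) = (case blocks w of [] \<Rightarrow> [] | (k, j) # rest \<Rightarrow> (Suc k, j) # rest)"

definition Lsh_trunc :: "nat \<Rightarrow> letter list \<Rightarrow> nat \<Rightarrow> complex" where
  "Lsh_trunc r w M = (let bs = blocks w; n = length bs in
     \<Sum>ms \<in> {ms. length ms = n \<and> sorted_wrt (>) (M # ms @ [0])}.
       \<Prod>i<n. root r (snd (bs ! i)) ^ (ms ! i - (ms @ [0]) ! Suc i)
              / of_nat (ms ! i) ^ fst (bs ! i))"

definition Lsh_word :: "nat \<Rightarrow> letter list \<Rightarrow> complex" where
  "Lsh_word r w = lim (Lsh_trunc r w)"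

definition Lsh :: "nat \<Rightarrow> nc \<Rightarrow> complex" where
  "Lsh r P = (\<Sum>w \<in> supp P. of_rat (P w) * Lsh_word r w)"

end

theory Submission
  imports Defs "HOL-Real_Asymp.Real_Asymp" "HOL-Computational_Algebra.Formal_Power_Series"
begin

text \<open>
  Let the letters act on sequences \<open>f\<close> by \<open>(x f)(m) = a\<^sub>m \<Sum>\<^sub>k\<^sub>\<le>\<^sub>m f(k)\<close> and
  \<open>((x + y\<^sub>s) f)(m) = a\<^sub>m \<Sum>\<^sub>k\<^sub>\<le>\<^sub>m (1 - s)\<^sup>m\<^sup>-\<^sup>k f(k)\<close>, so that \<open>z\<close> is multiplication by \<open>a\<^sub>m\<close>, and let a
  word act on the delta sequence at 0.  With \<open>h\<^sub>m = a\<^sub>1 + \<dots> + a\<^sub>m\<close>, the derivation \<open>\<partial>\<^sub>1\<close> becomes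
  multiplication by \<open>- h\<^sub>m\<close>, and if the \<open>a\<^sub>j\<close> are power series with \<open>a\<^sub>j' = a\<^sub>j\<^sup>2 - c a\<^sub>j h\<^sub>j\<close>, then thetahat
  becomes \<open>d/dt\<close> plus a multiplication operator.  Hence \<open>ad(thetahat)\<^sup>n(\<partial>\<^sub>1)\<close> becomes multiplication by
  the \<open>n\<close>-th \<open>t\<close>-derivative \<open>q(m)\<close> of \<open>- h\<^sub>m\<close>.

  For \<open>a\<^sub>m = 1/m\<close> the binomial transform of the sequence of a word is the sequence of its truncated
  L-values, so \<open>L\<^sup>s\<^sup>h\<close> is the limit of the iterated differences at 0.  The multiplier \<open>q\<close> vanishes at 0 and
  is a combination of partial sums of completely monotone sequences; by the Leibniz rule for differences,
  multiplication by \<open>q\<close> is then a summation method that sends every sequence converging at rate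
  \<open>O(1 / sqrt j)\<close> to 0.

  That convergent words remain convergent follows since thetahat, corrected by left and right
  multiplication by \<open>z\<close>, preserves first letters; the iterated commutators commute with left multiplication
  by \<open>z\<close> because the evaluation at all sequences \<open>a\<close> is faithful on words that end in some \<open>y\<^sub>s\<close>.
\<close>

section \<open>Iterated differences and nested sums\<close>

text \<open>\<open>bdiff f i m\<close> is the \<open>i\<close>-th forward difference of \<open>f\<close> at \<open>m\<close> times \<open>(-1)\<^sup>i\<close>; at \<open>m = 0\<close> it is the
  binomial transform.\<close>

primrec bdiff :: "(nat \<Rightarrow> 'a::comm_ring_1) \<Rightarrow> nat \<Rightarrow> nat \<Rightarrow> 'a" where
  "bdiff f 0 = f"
| "bdiff f (Suc i) = (\<lambda>m. bdiff f i m - bdiff f i (Suc m))"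

lemma bdiff_add: "bdiff (\<lambda>m. f m + g m) i m = bdiff f i m + bdiff g i m"
  by (induction i arbitrary: m) auto

lemma bdiff_diff: "bdiff (\<lambda>m. f m - g m) i m = bdiff f i m - bdiff g i m"
  by (induction i arbitrary: m) auto

lemma bdiff_cmult: "bdiff (\<lambda>m. c * f m) i m = c * bdiff f i m"
  by (induction i arbitrary: m) (auto simp: algebra_simps)

lemma bdiff_shift: "bdiff (\<lambda>m. f (Suc m)) i m = bdiff f i (Suc m)"
  by (induction i arbitrary: m) auto

lemma bdiff_of_real:
  "bdiff (\<lambda>m. of_real (f m) :: 'a :: {real_algebra_1,comm_ring_1}) i m = of_real (bdiff f i m)"
  by (induction i arbitrary: m) auto

text \<open>The Leibniz rule for the linear factor \<open>m\<close>, arranged so that both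
  differences sit at the same point. Read backwards it controls division by the index.\<close>

lemma bdiff_index_mult:
  "bdiff (\<lambda>m. of_nat m * f m) (Suc i) m =
     of_nat (m + Suc i) * bdiff f (Suc i) m - of_nat (Suc i) * bdiff f i m"
proof (induction i arbitrary: m)
  case 0
  show ?case by (simp add: algebra_simps)
next
  case (Suc i)
  have "bdiff (\<lambda>m. of_nat m * f m) (Suc (Suc i)) m =
      bdiff (\<lambda>m. of_nat m * f m) (Suc i) m - bdiff (\<lambda>m. of_nat m * f m) (Suc i) (Suc m)"
    by simp
  then show ?case unfolding Suc.IH by (simp add: algebra_simps)
qed

text \<open>At \<open>n = 0\<close> this turns multiplication of sequences into a triangular matrix
  acting on the binomial transform of \<open>f\<close>.\<close>

lemma bdiff_leibniz:
  "bdiff (\<lambda>m. f m * g m) M n =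
     (\<Sum>j\<le>M. of_nat (M choose j) * bdiff f j n * bdiff g (M - j) (n + j))"
proof (induction M arbitrary: n)
  case 0
  show ?case by simp
next
  case (Suc M)
  define s where "s j = bdiff g (M - j) (Suc (n + j))" for j
  \<comment> \<open>\<open>A1\<close> splits each difference of \<open>g\<close>, \<open>A2\<close>
    each difference of \<open>f\<close> at \<open>Suc n\<close>. The common sum containing
    \<open>s\<close> cancels, and Pascal's rule in \<open>A3\<close> collects what is left.\<close>
  have A1: "(\<Sum>j\<le>M. of_nat (M choose j) * bdiff f j n * bdiff g (M - j) (n + j)) =
     (\<Sum>j\<le>M. of_nat (M choose j) * bdiff f j n * bdiff g (Suc M - j) (n + j))
     + (\<Sum>j\<le>M. of_nat (M choose j) * bdiff f j n * s j)"
    unfolding sum.distrib[symmetric]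
    by (intro sum.cong refl) (auto simp: s_def Suc_diff_le algebra_simps)
  have A2: "(\<Sum>j\<le>M. of_nat (M choose j) * bdiff f j (Suc n) * bdiff g (M - j) (Suc n + j)) =
     (\<Sum>j\<le>M. of_nat (M choose j) * bdiff f j n * s j)
     - (\<Sum>j\<le>M. of_nat (M choose j) * bdiff f (Suc j) n * s j)"
    unfolding sum_subtractf[symmetric]
    by (intro sum.cong refl) (auto simp: s_def algebra_simps)
  have A3: "(\<Sum>j\<le>Suc M. of_nat (Suc M choose j) * bdiff f j n * bdiff g (Suc M - j) (n + j))
     = (\<Sum>j\<le>M. of_nat (M choose j) * bdiff f j n * bdiff g (Suc M - j) (n + j))
     + (\<Sum>j\<le>M. of_nat (M choose j) * bdiff f (Suc j) n * s j)" (is "?L = ?R1 + ?R2")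
  proof -
    have "?R1 = (\<Sum>j\<le>Suc M. of_nat (M choose j) * bdiff f j n * bdiff g (Suc M - j) (n + j))"
      by (simp add: binomial_eq_0)
    also have "\<dots> = f n * bdiff g (Suc M) n +
        (\<Sum>j\<le>M. of_nat (M choose Suc j) * bdiff f (Suc j) n * s j)"
      by (subst sum.atMost_Suc_shift) (simp add: s_def)
    finally have r1: "?R1 = f n * bdiff g (Suc M) n +
        (\<Sum>j\<le>M. of_nat (M choose Suc j) * bdiff f (Suc j) n * s j)" .
    have "?L = f n * bdiff g (Suc M) n +
        (\<Sum>j\<le>M. of_nat (Suc M choose Suc j) * bdiff f (Suc j) n * s j)"
      by (subst sum.atMost_Suc_shift) (simp add: s_def)
    also have "\<dots> = f n * bdiff g (Suc M) n +
        (\<Sum>j\<le>M. of_nat (M choose Suc j) * bdiff f (Suc j) n * s j) + ?R2"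
      unfolding add.assoc sum.distrib[symmetric]
      by (intro arg_cong2[where f="(+)"] refl sum.cong) (auto simp: algebra_simps)
    finally show ?thesis using r1 by simp
  qed
  have "bdiff (\<lambda>m. f m * g m) (Suc M) n = (\<Sum>j\<le>M. of_nat (M choose j) * bdiff f j n * bdiff g (M - j) (n + j))
     - (\<Sum>j\<le>M. of_nat (M choose j) * bdiff f j (Suc n) * bdiff g (M - j) (Suc n + j))"
    by (simp only: bdiff.simps Suc.IH)
  then show ?case unfolding A1 A2 A3 by simp
qed

section \<open>Binomial transforms of the delta sequence and of geometric partial sums\<close>

lemma bdiff_delta: "bdiff (\<lambda>m. if m = 0 then 1 else 0) i m = (if m = 0 then 1 else 0)"
  by (induction i arbitrary: m) auto

text \<open>With \<open>0 ^ 0 = 1\<close> the ratio 0 gives the identity and the ratio 1 ordinary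
  partial sums, so one operator serves all letters.\<close>

definition gsum :: "'a::comm_ring_1 \<Rightarrow> (nat \<Rightarrow> 'a) \<Rightarrow> nat \<Rightarrow> 'a" where
  "gsum t f m = (\<Sum>k\<le>m. t ^ (m - k) * f k)"

lemma gsum_0 [simp]: "gsum t f 0 = f 0"
  by (simp add: gsum_def)

lemma gsum_Suc: "gsum t f (Suc m) = t * gsum t f m + f (Suc m)"
proof -
  have "(\<Sum>k\<le>m. t ^ (Suc m - k) * f k) = t * (\<Sum>k\<le>m. t ^ (m - k) * f k)"
    unfolding sum_distrib_left by (intro sum.cong refl) (auto simp: Suc_diff_le algebra_simps)
  then show ?thesis by (simp add: gsum_def)
qed

lemma bdiff_gsum:
  "bdiff (gsum t f) i (Suc m) = t * bdiff (gsum t f) i m + bdiff f i (Suc m)"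
  by (induction i arbitrary: m) (auto simp: gsum_Suc algebra_simps)

text \<open>The recursion for \<open>gsum\<close> commutes with differences, and passing to the
  binomial transform exchanges the ratios \<open>t\<close> and \<open>1 - t\<close>. This is the
  reason for using \<open>1 - root r s\<close> on sequences: the transform then has the ratio
  \<open>root r s\<close> of the L-series.\<close>

lemma bdiff_gsum_0:
  assumes "\<And>n. bdiff f n 0 = (\<Sum>k\<le>n. c k)"
  shows "bdiff (gsum t f) n 0 = gsum (1 - t) c n"
proof (induction n)
  case 0
  show ?case using assms[of 0] by simp
next
  case (Suc n)
  have "bdiff (gsum t f) (Suc n) 0 = (1 - t) * bdiff (gsum t f) n 0 - bdiff f n (Suc 0)"
    using bdiff_gsum[of t f n 0] by (simp add: algebra_simps)
  also have "bdiff f n (Suc 0) = bdiff f n 0 - bdiff f (Suc n) 0" by simp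
  also have "\<dots> = - c (Suc n)" unfolding assms by simp
  finally show ?case using Suc by (simp add: gsum_Suc)
qed

text \<open>Since \<open>f 0 = 0\<close>, \<open>f\<close> is \<open>m\<close> times the quotient,
  and \<open>bdiff_index_mult\<close> at 0 gives the increments of the transform of the quotient.
  The summand \<open>k = 0\<close> is 0 by the convention \<open>x / 0 = 0\<close>.\<close>

lemma bdiff_divide_index:
  fixes f :: "nat \<Rightarrow> 'a::field_char_0"
  assumes "f 0 = 0"
  shows "bdiff (\<lambda>m. 1 / of_nat m * f m) n 0 = (\<Sum>k\<le>n. bdiff f k 0 / of_nat k)"
proof (induction n)
  case 0
  show ?case by simp
next
  case (Suc n)
  define g where "g = (\<lambda>m. 1 / of_nat m * f m)"
  have "f = (\<lambda>m. of_nat m * g m)" using assms by (auto simp: g_def fun_eq_iff)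
  then have "bdiff f (Suc n) 0 = of_nat (Suc n) * (bdiff g (Suc n) 0 - bdiff g n 0)"
    using bdiff_index_mult[of g n 0] by (simp only: right_diff_distrib) simp
  then have "bdiff g (Suc n) 0 - bdiff g n 0 = bdiff f (Suc n) 0 / of_nat (Suc n)"
    by (simp del: of_nat_Suc bdiff.simps)
  then show ?case using Suc unfolding g_def[symmetric]
    by (simp del: of_nat_Suc bdiff.simps add: algebra_simps)
qed

text \<open>A word acts on the delta sequence at 0, rightmost letter first. The data
  \<open>\<sigma>\<close> and \<open>a\<close> stay free because three kinds of sequences are used:
  \<open>1 / m\<close>, power series in a time variable, and arbitrary complex sequences.\<close>

fun nest :: "(nat \<Rightarrow> 'a::comm_ring_1) \<Rightarrow> (nat \<Rightarrow> 'a) \<Rightarrow> letter list \<Rightarrow> nat \<Rightarrow> 'a" where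
  "nest \<sigma> a [] = (\<lambda>m. if m = 0 then 1 else 0)"
| "nest \<sigma> a (X # w) = (\<lambda>m. a m * gsum 1 (nest \<sigma> a w) m)"
| "nest \<sigma> a (Y s # w) = (\<lambda>m. a m * (gsum (\<sigma> s) (nest \<sigma> a w) m - gsum 1 (nest \<sigma> a w) m))"

text \<open>The part of the L-series with outermost summation index \<open>m\<close>. The delta
  sequence of the empty word acts as a terminal index 0, which makes the last numerator a power with
  exponent equal to the innermost index.\<close>

fun ell :: "nat \<Rightarrow> letter list \<Rightarrow> nat \<Rightarrow> complex" where
  "ell r [] = (\<lambda>m. if m = 0 then 1 else 0)"
| "ell r (X # w) = (\<lambda>m. ell r w m / of_nat m)"
| "ell r (Y s # w) = (\<lambda>m. (\<Sum>k<m. root r s ^ (m - k) * ell r w k) / of_nat m)"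

definition ends_Y :: "letter list \<Rightarrow> bool" where
  "ends_Y w \<longleftrightarrow> w \<noteq> [] \<and> (\<exists>s. last w = Y s)"

lemma gsum_zero: "gsum 0 f m = f m"
  by (cases m) (auto simp: gsum_Suc)

lemma gsum_minus_last: "gsum t f m - f m = (\<Sum>k<m. t ^ (m - k) * f k)"
proof -
  have "{..m} = insert m {..<m}" by auto
  then show ?thesis by (simp add: gsum_def)
qed

lemma nest_0: "a 0 = 0 \<Longrightarrow> nest \<sigma> a w 0 = (if w = [] then 1 else 0)"
  by (cases "(\<sigma>, a, w)" rule: nest.cases) auto

text \<open>Under the exchange of ratios in \<open>bdiff_gsum_0\<close>, the ratio 1 of
  \<open>X\<close> becomes 0, so that only the division by the index remains; for \<open>Y s\<close>
  the difference of two ratios becomes a sum over strictly smaller indices.\<close>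

lemma bdiff_nest:
  assumes "w = [] \<or> ends_Y w"
  shows "bdiff (nest (\<lambda>s. 1 - root r s) (\<lambda>m. 1 / of_nat m) w) n 0 = (\<Sum>k\<le>n. ell r w k)"
  using assms
proof (induction w arbitrary: n)
  case Nil
  show ?case using bdiff_delta[of n 0] by simp
next
  case (Cons a w)
  let ?v = "nest (\<lambda>s. 1 - root r s) (\<lambda>m. 1 / of_nat m)"
  have w: "w = [] \<or> ends_Y w" using Cons.prems by (auto simp: ends_Y_def split: if_splits)
  note IH = Cons.IH[OF w]
  show ?case
  proof (cases a)
    case X
    \<comment> \<open>A nonempty tail evaluates to 0 at index 0, as
      \<open>bdiff_divide_index\<close> requires.\<close>
    then have "w \<noteq> []" using Cons.prems by (auto simp: ends_Y_def)
    then have "?v w 0 = 0" by (simp add: nest_0)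
    then show ?thesis using X bdiff_divide_index[of "gsum 1 (?v w)" n]
      by (simp add: bdiff_gsum_0[OF IH] gsum_zero)
  next
    case (Y s)
    have "bdiff (gsum (1 - root r s) (?v w)) k 0 - bdiff (gsum 1 (?v w)) k 0
        = (\<Sum>l<k. root r s ^ (k - l) * ell r w l)" for k
      by (simp add: bdiff_gsum_0[OF IH] gsum_zero gsum_minus_last)
    then show ?thesis
      using Y bdiff_divide_index[of "\<lambda>m. gsum (1 - root r s) (?v w) m - gsum 1 (?v w) m" n]
      by (simp add: bdiff_diff)
  qed
qed

section \<open>Truncated multiple L-values\<close>

fun block_sum :: "nat \<Rightarrow> (nat \<times> nat) list \<Rightarrow> nat \<Rightarrow> complex" where
  "block_sum r [] = (\<lambda>m. if m = 0 then 1 else 0)"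
| "block_sum r ((k, j) # bs) =
     (\<lambda>m. (\<Sum>l<m. root r j ^ (m - l) * block_sum r bs l) / of_nat m ^ k)"

text \<open>A leading \<open>X\<close> raises the first exponent by one, which is one more division
  by \<open>m\<close>. Trailing letters \<open>X\<close> are dropped by \<open>blocks\<close> but
  not by \<open>ell\<close>, hence the condition on the last letter.\<close>

lemma block_sum_blocks:
  assumes "w = [] \<or> ends_Y w"
  shows "block_sum r (blocks w) = ell r w"
  using assms
proof (induction w rule: blocks.induct)
  case (3 w)
  then have e: "ends_Y w" by (auto simp: ends_Y_def split: if_splits)
  have ne: "ends_Y u \<Longrightarrow> blocks u \<noteq> []" for u
    by (induction u rule: blocks.induct) (auto simp: ends_Y_def split: list.splits if_splits)
  then obtain k j bs where b: "blocks w = (k, j) # bs"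
    using e by (metis list.exhaust prod.exhaust)
  have "ell r w = block_sum r ((k, j) # bs)" using 3 e b by simp
  then show ?case by (simp add: b fun_eq_iff mult.commute)
qed (auto simp: ends_Y_def split: if_splits)

definition desc_lists :: "nat \<Rightarrow> nat \<Rightarrow> nat list set" where
  "desc_lists M n = {ms. length ms = n \<and> sorted_wrt (>) (M # ms @ [0])}"

lemma desc_lists_0: "desc_lists M 0 = (if M = 0 then {} else {[]})"
  by (auto simp: desc_lists_def)

lemma desc_lists_Suc: "desc_lists M (Suc n) = (\<Union>m<M. (#) m ` desc_lists m n)"
proof -
  have "ms \<in> desc_lists M (Suc n) \<longleftrightarrow> (\<exists>m<M. \<exists>ms'\<in>desc_lists m n. ms = m # ms')" for ms
    by (cases ms) (auto simp: desc_lists_def)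
  then show ?thesis by (intro set_eqI) (simp only: UN_iff image_iff lessThan_iff Bex_def)
qed

lemma finite_desc_lists: "finite (desc_lists M n)"
  by (induction n arbitrary: M) (auto simp: desc_lists_0 desc_lists_Suc)

lemma sum_desc_lists_Suc:
  "(\<Sum>ms\<in>desc_lists M (Suc n). f ms) = (\<Sum>m<M. \<Sum>ms\<in>desc_lists m n. f (m # ms))"
proof -
  have "(\<Sum>ms\<in>desc_lists M (Suc n). f ms) = (\<Sum>m<M. \<Sum>ms\<in>(#) m ` desc_lists m n. f ms)"
    unfolding desc_lists_Suc by (rule sum.UNION_disjoint) (auto simp: finite_desc_lists)
  also have "\<dots> = (\<Sum>m<M. \<Sum>ms\<in>desc_lists m n. f (m # ms))"
    by (rule sum.cong[OF refl]) (subst sum.reindex, auto)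
  finally show ?thesis .
qed

text \<open>The weight \<open>\<phi>\<close> on the largest index carries the induction: in the step
  it becomes \<open>root r j ^ (m - l)\<close> as a function of the next index \<open>l\<close>. The
  appended 0 is the largest index of the empty list and also the terminal index in the last
  exponent.\<close>

lemma sum_desc_lists_block_sum:
  "(\<Sum>ms\<in>desc_lists M (length bs). \<phi> ((ms @ [0]) ! 0) *
      (\<Prod>i<length bs. root r (snd (bs ! i)) ^ (ms ! i - (ms @ [0]) ! Suc i)
              / of_nat (ms ! i) ^ fst (bs ! i))) = (\<Sum>m<M. \<phi> m * block_sum r bs m)"
proof (induction bs arbitrary: M \<phi>)
  case Nil
  have "(\<Sum>m<M. \<phi> m * (if m = 0 then 1 else 0)) = (\<Sum>m<M. if m = 0 then \<phi> 0 else 0)"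
    by (intro sum.cong) auto
  then show ?case by (simp add: desc_lists_0)
next
  case (Cons b bs)
  obtain k j where b: "b = (k, j)" by fastforce
  let ?P = "\<lambda>ms. \<Prod>i<length bs. root r (snd (bs ! i)) ^ (ms ! i - (ms @ [0]) ! Suc i)
              / of_nat (ms ! i) ^ fst (bs ! i)"
  have "(\<Sum>ms\<in>desc_lists M (length (b # bs)). \<phi> ((ms @ [0]) ! 0) *
      (\<Prod>i<length (b # bs). root r (snd ((b # bs) ! i)) ^ (ms ! i - (ms @ [0]) ! Suc i)
              / of_nat (ms ! i) ^ fst ((b # bs) ! i)))
    = (\<Sum>m<M. \<Sum>ms\<in>desc_lists m (length bs).
         \<phi> m * (root r j ^ (m - (ms @ [0]) ! 0) / of_nat m ^ k * ?P ms))"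
    by (simp add: sum_desc_lists_Suc prod.lessThan_Suc_shift b del: prod.lessThan_Suc)
  also have "\<dots> = (\<Sum>m<M. \<phi> m / of_nat m ^ k *
       (\<Sum>ms\<in>desc_lists m (length bs). root r j ^ (m - (ms @ [0]) ! 0) * ?P ms))"
    by (simp add: sum_distrib_left mult_ac)
  also have "\<dots> = (\<Sum>m<M. \<phi> m * block_sum r (b # bs) m)"
    unfolding Cons.IH[of "\<lambda>l. root r j ^ (_ - l)"] by (simp add: b)
  finally show ?case .
qed

lemma Lsh_trunc_eq:
  assumes "w = [] \<or> ends_Y w"
  shows "Lsh_trunc r w M = (\<Sum>m<M. ell r w m)"
  using sum_desc_lists_block_sum[of "\<lambda>_. 1" r "blocks w" M]
  unfolding Lsh_trunc_def Let_def desc_lists_def[symmetric] block_sum_blocks[OF assms] by simp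

section \<open>Growth of powers of harmonic numbers\<close>

lemma harm_ge_1: "n \<ge> 1 \<Longrightarrow> (harm n :: real) \<ge> 1"
  using harm_mono[of 1 n, where ?'a = real] by (simp add: harm_def)

lemma harm_power_sum_le: "(\<Sum>k\<le>n. (harm k :: real) ^ p / of_nat k) \<le> harm n ^ Suc p"
proof -
  have "(\<Sum>k\<le>n. (harm k :: real) ^ p / of_nat k) \<le> (\<Sum>k\<le>n. harm n ^ p / of_nat k)"
    by (intro sum_mono divide_right_mono power_mono harm_mono harm_nonneg) auto
  also have "\<dots> = harm n ^ p * (\<Sum>k\<le>n. 1 / of_nat k)"
    by (simp add: sum_distrib_left)
  also have "(\<Sum>k\<le>n. 1 / of_nat k) = (harm n :: real)"
    unfolding harm_def by (rule sum.mono_neutral_cong_right) (auto simp: field_simps)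
  finally show ?thesis by (simp add: mult.commute)
qed

lemma harm_power_sum_less: "(\<Sum>k<n. (harm k :: real) ^ p / of_nat k) \<le> harm n ^ Suc p"
proof -
  have "(\<Sum>k<n. (harm k :: real) ^ p / of_nat k) \<le> (\<Sum>k\<le>n. (harm k :: real) ^ p / of_nat k)"
    by (intro sum_mono2) (auto intro!: divide_nonneg_nonneg zero_le_power harm_nonneg)
  then show ?thesis using harm_power_sum_le[of p n] by linarith
qed

lemma harm_power_le: "p \<le> q \<Longrightarrow> n \<ge> 1 \<Longrightarrow> (harm n :: real) ^ p \<le> harm n ^ q"
  by (intro power_increasing harm_ge_1)

lemma harm_power_over_sqrt_tendsto_0: "(\<lambda>n. (harm n :: real) ^ p / sqrt n) \<longlonglongrightarrow> 0"
proof -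
  have "harm n \<le> ln (real n) + 1" if "n \<ge> 1" for n
    using that
  proof (induction n rule: dec_induct)
    case base
    show ?case by (simp add: harm_def)
  next
    case (step n)
    have "ln (real n / real (Suc n)) \<le> real n / real (Suc n) - 1"
      using step by (intro ln_le_minus_one) auto
    also have "\<dots> = - 1 / real (Suc n)" by (simp add: field_simps)
    finally show ?case using step by (simp add: harm_Suc ln_div inverse_eq_divide)
  qed
  then have *: "(harm n :: real) ^ p / sqrt n \<le> (ln (real n) + 1) ^ p / sqrt n" if "n \<ge> 1" for n
    using that by (intro divide_right_mono power_mono harm_nonneg) auto
  have "((\<lambda>x::real. (ln x + 1) ^ p / sqrt x) \<longlongrightarrow> 0) at_top"
    by real_asymp
  then have "(\<lambda>n. (ln (real n) + 1) ^ p / sqrt n) \<longlonglongrightarrow> 0"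
    using filterlim_real_sequentially by (rule filterlim_compose)
  then show ?thesis
    by (rule tendsto_sandwich[OF _ _ tendsto_const, rotated 2])
      (auto intro!: eventually_sequentiallyI[of 1] * divide_nonneg_nonneg zero_le_power harm_nonneg)
qed

text \<open>The summand 1 covers \<open>n = 0\<close> and \<open>p = 0\<close>, where the left side
  is 1 and the square root is 0.\<close>

lemma harm_power_le_sqrt: "\<exists>C>0. \<forall>n. (harm n :: real) ^ p \<le> C * sqrt n + 1"
proof -
  have "Bseq (\<lambda>n. (harm n :: real) ^ p / sqrt n)"
    using harm_power_over_sqrt_tendsto_0 by (intro convergent_imp_Bseq) (auto simp: convergent_def)
  then obtain C where C: "C > 0" "\<And>n. norm ((harm n :: real) ^ p / sqrt n) \<le> C"
    unfolding Bseq_def by auto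
  have "(harm n :: real) ^ p \<le> C * sqrt n + 1" for n
  proof (cases "n = 0")
    case True
    then show ?thesis by (cases "p = 0") (auto simp: harm_def zero_power)
  next
    case False
    then show ?thesis using C(2)[of n]
      by (auto simp: harm_nonneg field_simps abs_mult)
  qed
  then show ?thesis using C(1) by blast
qed

section \<open>Rate of convergence\<close>

lemma norm_root [simp]: "norm (root r s) = 1"
  by (simp add: root_def)

text \<open>Each letter costs at most one harmonic factor, by \<open>harm_power_sum_less\<close>.
  One-letter words are treated separately because \<open>ell r []\<close> has the value 1 at index
  0, where the bound would read 0.\<close>

lemma norm_ell_le:
  assumes "w \<noteq> []"
  shows "norm (ell r w n) \<le> harm n ^ length w / of_nat n"
  using assms
proof (induction w arbitrary: n)
  case (Cons a w)
  show ?case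
  proof (cases "n = 0")
    case True
    then show ?thesis by (cases a) auto
  next
    case False
    then have h: "(harm n :: real) \<ge> 1" by (intro harm_ge_1) auto
    show ?thesis
    proof (cases "w = []")
      case True
      have "norm (ell r (a # w) n) \<le> 1 / of_nat n"
      proof (cases a)
        case (Y s)
        have "(\<Sum>k<n. root r s ^ (n - k) * ell r w k) = (\<Sum>k<n. if k = 0 then root r s ^ n else 0)"
          using True by (intro sum.cong) auto
        then show ?thesis using Y False by (simp add: norm_divide norm_power)
      qed (use True False in auto)
      also have "\<dots> \<le> harm n ^ length (a # w) / of_nat n"
        using h by (intro divide_right_mono one_le_power) auto
      finally show ?thesis .
    next
      case w: False
      show ?thesis
      proof (cases a)
        case X
        have "norm (ell r (a # w) n) = norm (ell r w n) / of_nat n"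
          using X by (simp add: norm_divide)
        also have "\<dots> \<le> norm (ell r w n)"
          using False divide_left_mono[of 1 "real n" "norm (ell r w n)"] by simp
        also have "\<dots> \<le> harm n ^ length w / of_nat n" by (rule Cons.IH[OF w])
        also have "\<dots> \<le> harm n ^ length (a # w) / of_nat n"
          using False by (intro divide_right_mono harm_power_le) auto
        finally show ?thesis .
      next
        case (Y s)
        have "norm (\<Sum>k<n. root r s ^ (n - k) * ell r w k) \<le> (\<Sum>k<n. norm (ell r w k))"
          by (rule order.trans[OF norm_sum]) (auto simp: norm_mult norm_power)
        also have "\<dots> \<le> (\<Sum>k<n. harm k ^ length w / of_nat k)"
          by (intro sum_mono Cons.IH w)
        also have "\<dots> \<le> harm n ^ length (a # w)"
          using harm_power_sum_less[of "length w" n] by simp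
        finally show ?thesis using Y by (simp add: norm_divide divide_right_mono)
      qed
    qed
  qed
qed auto

text \<open>With \<open>s = sqrt k\<close> and \<open>t = sqrt (Suc k)\<close> the difference of
  reciprocals is \<open>1 / (s * t * (s + t))\<close>, and \<open>t \<le> 3/2 * s\<close> bounds
  \<open>t * (s + t)\<close> by \<open>4 * (s * s)\<close>.\<close>

lemma inverse_three_halves_telescope:
  assumes "k \<ge> 1"
  shows "1 / (real k * sqrt k) \<le> 4 * (1 / sqrt k - 1 / sqrt (Suc k))"
proof -
  define s t where "s = sqrt k" and "t = sqrt (Suc k)"
  have s: "s \<ge> 1" "s * s = k" and t: "t > s" "t * t = k + 1"
    using assms by (auto simp: s_def t_def)
  have "t \<le> 3/2 * s"
  proof (rule power2_le_imp_le)
    show "t\<^sup>2 \<le> (3/2 * s)\<^sup>2"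
      using s(2) t(2) assms by (simp add: power2_eq_square)
  qed (use s in auto)
  then have "t * (s + t) \<le> (3/2 * s) * (5/2 * s)"
    using s t by (intro mult_mono) auto
  also have "\<dots> \<le> 4 * (s * s)" by simp
  finally have 1: "t * (s + t) \<le> 4 * (s * s)" .
  have "(t - s) * (s + t) = 1" using s t by (simp add: algebra_simps)
  then have "t - s = 1 / (s + t)" using s t by (simp add: eq_divide_eq)
  moreover have "1 / s - 1 / t = (t - s) / (s * t)" using s t by (simp add: field_simps)
  ultimately have "1 / s - 1 / t = 1 / (s * t * (s + t))" by simp
  moreover have "1 / (s * s * s) \<le> 4 * (1 / (s * t * (s + t)))"
  proof -
    have "s * t * (s + t) \<le> 4 * (s * s * s)"
      using mult_left_mono[OF 1, of s] s by (simp add: mult_ac)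
    then have "4 / (4 * (s * s * s)) \<le> 4 / (s * t * (s + t))"
      using s t by (intro divide_left_mono mult_pos_pos) auto
    then show ?thesis by simp
  qed
  moreover have "real k * sqrt k = s * s * s" by (simp add: s_def)
  ultimately show ?thesis unfolding s_def t_def by (simp only:)
qed

lemma sum_inverse_three_halves_le:
  assumes "j \<le> i"
  shows "(\<Sum>k\<in>{j<..i}. 1 / (real k * sqrt k)) \<le> 4 * (1 / sqrt (Suc j) - 1 / sqrt (Suc i))"
  using assms
proof (induction i rule: dec_induct)
  case base
  show ?case by simp
next
  case (step i)
  have "{j<..Suc i} = insert (Suc i) {j<..i}" using step by auto
  then show ?case using step inverse_three_halves_telescope[of "Suc i"] by simp
qed

text \<open>The form in which summation by parts is used: a telescoping part plus an absolutely
  summable remainder, both with tails of order \<open>1 / sqrt j\<close>. The term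
  \<open>x 0\<close> is unrestricted because only tails are compared.\<close>

lemma convergence_rate:
  fixes x \<beta> e :: "nat \<Rightarrow> complex"
  assumes x: "\<And>k. k \<ge> 1 \<Longrightarrow> x k = \<beta> k - \<beta> (Suc k) + e k"
    and \<beta>: "\<And>k. k \<ge> 1 \<Longrightarrow> norm (\<beta> k) \<le> C / sqrt k"
    and e: "\<And>k. k \<ge> 1 \<Longrightarrow> norm (e k) \<le> C / (k * sqrt k)"
  shows "\<exists>L C. \<forall>j. norm ((\<Sum>k\<le>j. x k) - L) \<le> C / sqrt (Suc j)"
proof -
  define t where "t j = (\<Sum>k\<le>j. x k)" for j
  have C: "C \<ge> 0" using order.trans[OF norm_ge_zero \<beta>[of 1]] by simp
  have diff: "norm (t i - t j) \<le> 6 * C / sqrt (Suc j)" if "j \<le> i" for i j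
  proof -
    have "t i - t j = \<beta> (Suc j) - \<beta> (Suc i) + (\<Sum>k\<in>{j<..i}. e k)"
      using that
    proof (induction i rule: dec_induct)
      case (step i)
      have "{j<..Suc i} = insert (Suc i) {j<..i}" using step by auto
      moreover have "t (Suc i) - t j = (t i - t j) + x (Suc i)" by (simp add: t_def)
      ultimately show ?case unfolding step.IH x[of "Suc i", simplified] by simp
    qed (simp add: t_def)
    also have "norm \<dots> \<le> norm (\<beta> (Suc j)) + norm (\<beta> (Suc i)) + norm (\<Sum>k\<in>{j<..i}. e k)"
      by (meson add_mono_thms_linordered_semiring(3) norm_triangle_ineq norm_triangle_ineq4 order_trans)
    also have "norm (\<Sum>k\<in>{j<..i}. e k) \<le> (\<Sum>k\<in>{j<..i}. C * (1 / (k * sqrt k)))"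
      using e by (intro order.trans[OF norm_sum] sum_mono) auto
    also have "\<dots> \<le> C * (4 * (1 / sqrt (Suc j) - 1 / sqrt (Suc i)))"
      unfolding sum_distrib_left[symmetric] using that C
      by (intro mult_left_mono sum_inverse_three_halves_le)
    also have "norm (\<beta> (Suc j)) \<le> C / sqrt (Suc j)" by (rule \<beta>) auto
    also have "norm (\<beta> (Suc i)) \<le> C / sqrt (Suc i)" by (rule \<beta>) auto
    finally have "norm (t i - t j) \<le> C / sqrt (Suc j) + C / sqrt (Suc i)
       + C * (4 * (1 / sqrt (Suc j) - 1 / sqrt (Suc i)))" by simp
    also have "\<dots> = 5 * (C / sqrt (Suc j)) - 3 * (C / sqrt (Suc i))"
    proof -
      have "C * (4 * (1 / sqrt (Suc j) - 1 / sqrt (Suc i))) = 4 * (C / sqrt (Suc j)) - 4 * (C / sqrt (Suc i))"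
        by (simp add: algebra_simps)
      then show ?thesis by linarith
    qed
    also have "\<dots> \<le> 6 * C / sqrt (Suc j)"
    proof -
      have "C / sqrt (Suc j) \<ge> 0" "C / sqrt (Suc i) \<ge> 0" using C by auto
      then show ?thesis unfolding times_divide_eq_right[symmetric] by linarith
    qed
    finally show ?thesis .
  qed
  have "(\<lambda>j. 6 * C / sqrt (Suc j)) \<longlonglongrightarrow> 0" by real_asymp
  then have "Cauchy t"
    unfolding Cauchy_altdef2
  proof (intro allI impI)
    fix \<epsilon> :: real assume \<epsilon>: "\<epsilon> > 0"
    have "eventually (\<lambda>j. 6 * C / sqrt (Suc j) < \<epsilon>) sequentially"
      using \<open>_ \<longlonglongrightarrow> 0\<close> \<epsilon> by (rule order_tendstoD)
    then obtain N where "6 * C / sqrt (Suc N) < \<epsilon>"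
      by (auto simp: eventually_sequentially)
    then show "\<exists>N. \<forall>n\<ge>N. dist (t n) (t N) < \<epsilon>"
      using diff by (intro exI[of _ N]) (force simp: dist_norm)
  qed
  then obtain L where L: "t \<longlonglongrightarrow> L"
    using Cauchy_convergent convergent_def by blast
  have "norm (t j - L) \<le> 6 * C / sqrt (Suc j)" for j
  proof -
    have "norm (L - t j) \<le> 6 * C / sqrt (Suc j)"
      by (rule Lim_bounded[of "\<lambda>i. norm (t i - t j)" _ j])
        (use diff[of j] in \<open>auto intro!: tendsto_intros L\<close>)
    then show ?thesis by (simp add: norm_minus_commute)
  qed
  then show ?thesis unfolding t_def by blast
qed

section \<open>Convergence rate for convergent words\<close>

lemma root_eq_1_iff:
  assumes "s < r" shows "root r s = 1 \<longleftrightarrow> s = 0"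
proof
  assume "root r s = 1"
  then have "cos (2 * pi * real s / real r) = 1" by (simp add: root_def complex_eq_iff)
  then obtain n :: int where n: "2 * pi * real s / real r = real_of_int n * 2 * pi"
    using cos_one_2pi_int by blast
  then have "real s = real_of_int n * real r" using assms by (simp add: field_simps)
  then have n: "int s = n * int r" by (metis of_int_eq_iff of_int_mult of_int_of_nat_eq)
  then have "int r dvd int s" by simp
  then show "s = 0" using assms zdvd_not_zless[of "int s" "int r"] by force
qed (simp add: root_def)

lemma mult_sqrt_divide_self: "n \<ge> 1 \<Longrightarrow> C * sqrt (real n) / real n = C / sqrt n"
  using sqrt_divide_self_eq[of "real n"]
  by (simp only: times_divide_eq_right[symmetric] divide_inverse[of C])

text \<open>If the first letter is \<open>X\<close>, the summands are already of order
  \<open>1 / (k * sqrt k)\<close>. If it is \<open>Y s\<close> with \<open>s \<noteq> 0\<close>,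
  then \<open>root r s \<noteq> 1\<close> and the oscillation is exploited by summation by
  parts.\<close>

lemma conv_word_rate:
  assumes "conv_word w" "w \<noteq> []" "\<forall>a\<in>set w. valid_letter r a"
  shows "\<exists>L C. \<forall>j. norm ((\<Sum>k\<le>j. ell r w k) - L) \<le> C / sqrt (Suc j)"
proof -
  obtain a u where w: "w = a # u" using assms(2) by (cases w) auto
  have u: "u \<noteq> []" using assms(1) w by (auto simp: conv_word_def)
  define p where "p = length u"
  obtain C0 where C0: "C0 > 0" "\<And>n. (harm n :: real) ^ Suc p \<le> C0 * sqrt n + 1"
    using harm_power_le_sqrt[of "Suc p"] by blast
  define C where "C = C0 + 1"
  have hC: "(harm n :: real) ^ Suc p \<le> C * sqrt n" if "n \<ge> 1" for n
  proof -
    have "sqrt n \<ge> 1" using that by simp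
    then show ?thesis using C0(2)[of n] unfolding C_def distrib_right by linarith
  qed
  have ell: "norm (ell r u k) / of_nat k \<le> C / (k * sqrt k)" if "k \<ge> 1" for k
  proof -
    have "norm (ell r u k) \<le> harm k ^ p / k" using norm_ell_le[OF u] by (simp add: p_def)
    also have "\<dots> \<le> harm k ^ Suc p / k" using that by (intro divide_right_mono harm_power_le) auto
    also have "\<dots> \<le> C * sqrt k / k" using that by (intro divide_right_mono hC) auto
    also have "\<dots> = C / sqrt k" using that by (rule mult_sqrt_divide_self)
    finally have "norm (ell r u k) / of_nat k \<le> C / sqrt k / k" by (rule divide_right_mono) auto
    then show ?thesis by (simp add: mult.commute)
  qed
  show ?thesis
  proof (cases a)
    case X
    show ?thesis unfolding w
      by (rule convergence_rate[of _ "\<lambda>_. 0" "ell r (a # u)" C])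
        (use ell X C0(1) in \<open>auto simp: norm_divide C_def\<close>)
  next
    case (Y s)
    have s: "s < r" "s \<noteq> 0" using assms Y w by (auto simp: conv_word_def valid_letter_def)
    then have r1: "1 - root r s \<noteq> 0" using root_eq_1_iff by auto
    define d where "d = norm (1 - root r s)"
    have d: "d > 0" using r1 by (simp add: d_def)
    define B where "B n = (\<Sum>k<n. root r s ^ (n - k) * ell r u k)" for n
    have B_Suc: "B (Suc n) = root r s * (B n + ell r u n)" for n
    proof -
      have "(\<Sum>k<n. root r s ^ (Suc n - k) * ell r u k) = root r s * B n"
        unfolding B_def sum_distrib_left by (intro sum.cong) (auto simp: Suc_diff_le)
      then show ?thesis by (simp add: B_def algebra_simps)
    qed
    have B_le: "norm (B n) \<le> C * sqrt n" if "n \<ge> 1" for n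
    proof -
      have "norm (B n) \<le> (\<Sum>k<n. norm (ell r u k))"
        unfolding B_def by (rule order.trans[OF norm_sum]) (auto simp: norm_mult norm_power)
      also have "\<dots> \<le> (\<Sum>k<n. harm k ^ p / of_nat k)"
        unfolding p_def by (intro sum_mono norm_ell_le u)
      also have "\<dots> \<le> harm n ^ Suc p"
        by (rule harm_power_sum_less)
      finally show ?thesis using hC[OF that] by linarith
    qed
    \<comment> \<open>By \<open>B_Suc\<close>, \<open>(1 - root r s) * B k\<close> equals
      \<open>B k - B (Suc k) + root r s * ell r u k\<close>. Dividing by \<open>k\<close> and
      replacing \<open>B (Suc k) / k\<close> by \<open>B (Suc k) / Suc k\<close> leaves the error
      \<open>e\<close>.\<close>
    define \<beta> where "\<beta> k = B k / of_nat k / (1 - root r s)" for k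
    define e where "e k = (root r s * ell r u k / of_nat k - B (Suc k) / (of_nat k * of_nat (Suc k)))
        / (1 - root r s)" for k
    show ?thesis unfolding w
    proof (rule convergence_rate[of _ \<beta> e "2 * C / d"])
      fix k :: nat assume k: "k \<ge> 1"
      have k0: "complex_of_nat k \<noteq> 0" "complex_of_nat (Suc k) \<noteq> 0"
        using k by (auto simp del: of_nat_Suc)
      have "(1 - root r s) * (\<beta> k - \<beta> (Suc k) + e k) =
          B k / of_nat k - B (Suc k) / of_nat (Suc k) +
          (root r s * ell r u k / of_nat k - B (Suc k) / (of_nat k * of_nat (Suc k)))"
        using r1 unfolding \<beta>_def e_def distrib_left right_diff_distrib[of "1 - root r s"]
        by (simp del: of_nat_Suc)
      also have "B (Suc k) / of_nat (Suc k) + B (Suc k) / (of_nat k * of_nat (Suc k)) = B (Suc k) / of_nat k"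
        using k0 by (simp add: divide_simps del: of_nat_Suc) (simp add: algebra_simps)
      then have "B k / of_nat k - B (Suc k) / of_nat (Suc k) +
          (root r s * ell r u k / of_nat k - B (Suc k) / (of_nat k * of_nat (Suc k)))
         = (B k + root r s * ell r u k - B (Suc k)) / of_nat k"
        by (simp add: diff_divide_distrib add_divide_distrib algebra_simps)
      also have "\<dots> = (1 - root r s) * (B k / of_nat k)" by (simp add: B_Suc algebra_simps)
      finally have "\<beta> k - \<beta> (Suc k) + e k = B k / of_nat k" using mult_left_cancel[OF r1] by blast
      then show "ell r (a # u) k = \<beta> k - \<beta> (Suc k) + e k" using Y by (simp add: B_def)
      have "norm (B k) / k \<le> C * sqrt k / k" by (intro divide_right_mono B_le k) auto
      also have "\<dots> = C / sqrt k" using k by (rule mult_sqrt_divide_self)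
      also have "\<dots> \<le> 2 * C / sqrt k" using C0 k by (intro divide_right_mono) (auto simp: C_def)
      finally have "norm (B k) / k / d \<le> 2 * C / sqrt k / d" using d by (intro divide_right_mono) auto
      then show "norm (\<beta> k) \<le> 2 * C / d / sqrt k"
        by (simp add: \<beta>_def norm_divide norm_mult d_def mult.commute)
      have "norm (B (Suc k)) / (k * Suc k) \<le> C * sqrt (Suc k) / (k * Suc k)"
        by (intro divide_right_mono B_le) auto
      also have "\<dots> = C / (k * sqrt (Suc k))"
      proof -
        have "C * sqrt (Suc k) / (k * Suc k) = C * sqrt (Suc k) / Suc k / k"
          by (simp add: algebra_simps)
        also have "\<dots> = C / sqrt (Suc k) / k"
          by (subst mult_sqrt_divide_self) auto
        finally show ?thesis by (simp add: mult.commute)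
      qed
      also have "\<dots> \<le> C / (k * sqrt k)"
        using C0 k by (intro divide_left_mono mult_left_mono mult_pos_pos) (auto simp: C_def)
      finally have 1: "norm (B (Suc k)) / (k * Suc k) \<le> C / (k * sqrt k)" .
      have "norm (root r s * ell r u k / of_nat k - B (Suc k) / (of_nat k * of_nat (Suc k)))
          \<le> norm (ell r u k) / k + norm (B (Suc k)) / (k * Suc k)"
        by (rule order.trans[OF norm_triangle_ineq4]) (simp add: norm_divide norm_mult algebra_simps del: of_nat_Suc, simp add: algebra_simps)
      also have "\<dots> \<le> 2 * (C / (k * sqrt k))"
        using add_mono[OF ell[OF k] 1] by (simp only: mult_2)
      finally have "norm (root r s * ell r u k / of_nat k - B (Suc k) / (of_nat k * of_nat (Suc k))) / d
          \<le> 2 * (C / (k * sqrt k)) / d" using d by (intro divide_right_mono) auto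
      then show "norm (e k) \<le> 2 * C / d / (k * sqrt k)"
        by (simp add: e_def norm_divide norm_mult d_def mult.commute mult.left_commute del: of_nat_Suc)
    qed
  qed
qed

section \<open>Completely monotone multipliers\<close>

text \<open>Complete monotonicity is asked only from index 1 on, since \<open>1 / m\<close> has the
  value 0 at 0. The two bounds control high differences at 1 and values far out; the exponent
  \<open>p\<close> absorbs the logarithms that the closure operations produce.\<close>

definition moderate_cm :: "nat \<Rightarrow> (nat \<Rightarrow> real) \<Rightarrow> bool" where
  "moderate_cm p g \<longleftrightarrow> g 0 = 0 \<and> (\<forall>i m. m \<ge> 1 \<longrightarrow> bdiff g i m \<ge> 0) \<and>
     (\<forall>i. bdiff g i 1 \<le> harm (Suc i) ^ p / Suc i) \<and> (\<forall>m. g m \<le> harm m ^ p / m)"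

text \<open>\<open>bdiff_index_mult\<close> for the quotient. As \<open>m * (g m / m) = g m\<close>
  may fail at 0, the sequences are first shifted by one.\<close>

lemma bdiff_divide_index_Suc:
  fixes g :: "nat \<Rightarrow> real"
  assumes "m \<ge> 1"
  shows "real (m + Suc i) * bdiff (\<lambda>m. 1 / real m * g m) (Suc i) m =
    bdiff g (Suc i) m + real (Suc i) * bdiff (\<lambda>m. 1 / real m * g m) i m"
proof -
  define c where "c = (\<lambda>m. 1 / real m * g m)"
  obtain k where k: "m = Suc k" using assms by (cases m) auto
  have "bdiff (\<lambda>m. real m * c m) (Suc i) m = bdiff (\<lambda>m. real (Suc m) * c (Suc m)) (Suc i) k"
    unfolding k by (rule bdiff_shift[symmetric])
  also have "(\<lambda>m. real (Suc m) * c (Suc m)) = (\<lambda>m. g (Suc m))" by (auto simp: c_def)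
  also have "bdiff (\<lambda>m. g (Suc m)) (Suc i) k = bdiff g (Suc i) m"
    unfolding k by (rule bdiff_shift)
  finally show ?thesis using bdiff_index_mult[of c i m] unfolding c_def by linarith
qed

lemma bdiff_divide_index_at_1:
  fixes g :: "nat \<Rightarrow> real"
  shows "real (Suc i) * bdiff (\<lambda>m. 1 / real m * g m) i 1 = (\<Sum>l\<le>i. bdiff g l 1)"
proof (induction i)
  case (Suc i)
  show ?case using bdiff_divide_index_Suc[of 1 i g] Suc by (simp del: of_nat_Suc bdiff.simps)
qed simp

section \<open>Closure properties of moderate completely monotone sequences\<close>

lemma bdiff_const_Suc: "bdiff (\<lambda>_. c) (Suc i) m = 0"
  by (induction i arbitrary: m) auto

lemma bdiff_inverse_Suc:
  assumes "m \<ge> 1"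
  shows "real (m + Suc i) * bdiff (\<lambda>m. 1 / real m) (Suc i) m = real (Suc i) * bdiff (\<lambda>m. 1 / real m) i m"
  using bdiff_divide_index_Suc[OF assms, of i "\<lambda>_. 1"] bdiff_const_Suc[of 1 i m] by simp

lemma bdiff_inverse_at_1: "bdiff (\<lambda>m. 1 / real m) i 1 = 1 / real (Suc i)"
proof (induction i)
  case (Suc i)
  show ?case using bdiff_inverse_Suc[of 1 i] unfolding Suc by (simp add: field_simps del: bdiff.simps)
qed simp

lemma moderate_cm_inverse: "moderate_cm 0 (\<lambda>m. 1 / real m)"
proof -
  have "bdiff (\<lambda>m. 1 / real m) i m \<ge> 0" if "m \<ge> 1" for i m
  proof (induction i)
    case (Suc i)
    have "real (m + Suc i) * bdiff (\<lambda>m. 1 / real m) (Suc i) m \<ge> 0"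
      unfolding bdiff_inverse_Suc[OF that] using Suc by simp
    then show ?case by (simp add: zero_le_mult_iff del: bdiff.simps)
  qed simp
  then show ?thesis unfolding moderate_cm_def using bdiff_inverse_at_1 by auto
qed

lemma harm_power_sum_shift: "(\<Sum>l<n. (harm (Suc l) :: real) ^ p / Suc l) \<le> harm n ^ Suc p"
proof -
  have "(\<Sum>l<n. (harm (Suc l) :: real) ^ p / Suc l) = (\<Sum>l\<in>{1..n}. harm l ^ p / l)"
    by (rule sum.reindex_bij_witness[of _ "\<lambda>l. l - 1" Suc]) auto
  also have "\<dots> \<le> (\<Sum>l\<le>n. harm l ^ p / l)"
    by (intro sum_mono2) (auto intro!: divide_nonneg_nonneg zero_le_power harm_nonneg)
  finally show ?thesis using harm_power_sum_le[of p n] by linarith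
qed

lemma divide_le_self: "(a::real) \<ge> 0 \<Longrightarrow> n \<ge> 1 \<Longrightarrow> a / real n \<le> a"
  using divide_left_mono[of 1 "real n" a] by simp

text \<open>The recursion \<open>bdiff_divide_index_Suc\<close> has nonnegative coefficients, so
  positivity follows by induction on the order of the difference. The differences at 1 are averages
  of those of \<open>g\<close>.\<close>

lemma moderate_cm_divide:
  assumes "moderate_cm p g"
  shows "moderate_cm (Suc p) (\<lambda>m. 1 / real m * g m)"
proof -
  define c where "c = (\<lambda>m. 1 / real m * g m)"
  have g: "bdiff g i m \<ge> 0" if "m \<ge> 1" for i m using assms that by (auto simp: moderate_cm_def)
  have pos: "bdiff c i m \<ge> 0" if "m \<ge> 1" for i m
  proof (induction i)
    case 0
    show ?case using g[OF that, of 0] by (simp add: c_def)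
  next
    case (Suc i)
    have "real (m + Suc i) * bdiff c (Suc i) m \<ge> 0"
      unfolding c_def bdiff_divide_index_Suc[OF that] using Suc g[OF that, of "Suc i"]
      by (simp add: c_def del: bdiff.simps of_nat_Suc)
    then show ?case by (simp add: zero_le_mult_iff del: bdiff.simps)
  qed
  have "real (Suc i) * bdiff c i 1 \<le> harm (Suc i) ^ Suc p" for i
  proof -
    have "real (Suc i) * bdiff c i 1 = (\<Sum>l<Suc i. bdiff g l 1)"
      unfolding c_def bdiff_divide_index_at_1 lessThan_Suc_atMost by simp
    also have "\<dots> \<le> (\<Sum>l<Suc i. harm (Suc l) ^ p / Suc l)"
      by (intro sum_mono) (use assms in \<open>auto simp: moderate_cm_def\<close>)
    also have "\<dots> \<le> harm (Suc i) ^ Suc p" by (rule harm_power_sum_shift)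
    finally show ?thesis .
  qed
  then have b: "bdiff c i 1 \<le> harm (Suc i) ^ Suc p / Suc i" for i
    by (simp add: pos_le_divide_eq mult.commute del: of_nat_Suc power_Suc)
  have "c m \<le> harm m ^ Suc p / m" for m
  proof (cases "m = 0")
    case False
    have "c m \<le> g m" using divide_le_self[of "g m" m] g[of m 0] False by (auto simp: c_def)
    also have "\<dots> \<le> harm m ^ p / m" using assms by (auto simp: moderate_cm_def)
    also have "\<dots> \<le> harm m ^ Suc p / m" using False by (intro divide_right_mono harm_power_le) auto
    finally show ?thesis .
  qed (simp add: c_def)
  then show ?thesis using pos b unfolding moderate_cm_def c_def by simp
qed

text \<open>Here positivity is proved by induction on the point instead of the order: in
  \<open>rec\<close> the second term vanishes at \<open>m = 0\<close>, and all coefficients are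
  nonnegative.\<close>

lemma moderate_cm_cesaro:
  assumes "moderate_cm p g"
  shows "moderate_cm (Suc p) (\<lambda>m. 1 / real m * gsum 1 g m)"
proof -
  define c where "c = (\<lambda>m. 1 / real m * gsum 1 g m)"
  have g: "bdiff g i m \<ge> 0" if "m \<ge> 1" for i m
    using assms that by (auto simp: moderate_cm_def)
  have g0: "g 0 = 0" using assms by (auto simp: moderate_cm_def)
  have rec: "real (m + Suc i) * bdiff c i (Suc m) = bdiff g i (Suc m) + real m * bdiff c i m" for i m
  proof -
    have "gsum 1 g = (\<lambda>m. real m * c m)"
      by (rule ext) (auto simp: c_def g0)
    then have "bdiff (gsum 1 g) (Suc i) m = real (m + Suc i) * bdiff c (Suc i) m - real (Suc i) * bdiff c i m"
      using bdiff_index_mult[of c i m] by simp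
    moreover have "bdiff (gsum 1 g) (Suc i) m = - bdiff g i (Suc m)"
      by (simp add: bdiff_gsum)
    ultimately show ?thesis by (simp add: algebra_simps)
  qed
  have pos: "bdiff c i (Suc m) \<ge> 0" for i m
  proof (induction m)
    case 0
    have "real (0 + Suc i) * bdiff c i (Suc 0) \<ge> 0"
      unfolding rec using g[of "Suc 0" i] by simp
    then show ?case by (simp add: zero_le_mult_iff)
  next
    case (Suc m)
    have "real (Suc m + Suc i) * bdiff c i (Suc (Suc m)) \<ge> 0"
      unfolding rec using g[of "Suc (Suc m)" i] Suc by simp
    then show ?case by (simp add: zero_le_mult_iff)
  qed
  have pos: "bdiff c i m \<ge> 0" if "m \<ge> 1" for i m
    using pos[of i "m - 1"] that by simp
  have b: "bdiff c i 1 \<le> harm (Suc i) ^ Suc p / Suc i" for i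
  proof -
    have "real (Suc i) * bdiff c i 1 = bdiff g i 1" using rec[of 0 i] by simp
    then have "bdiff c i 1 = bdiff g i 1 / Suc i" by (simp add: field_simps)
    also have "\<dots> \<le> bdiff g i 1" using g[of 1 i] by (intro divide_le_self) auto
    also have "\<dots> \<le> harm (Suc i) ^ p / Suc i" using assms by (auto simp: moderate_cm_def)
    also have "\<dots> \<le> harm (Suc i) ^ Suc p / Suc i" by (intro divide_right_mono harm_power_le) auto
    finally show ?thesis .
  qed
  have "c m \<le> harm m ^ Suc p / m" for m
  proof -
    have "gsum 1 g m \<le> (\<Sum>k\<le>m. harm k ^ p / k)"
      unfolding gsum_def using assms by (intro sum_mono) (auto simp: moderate_cm_def)
    also have "\<dots> \<le> harm m ^ Suc p" by (rule harm_power_sum_le)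
    finally have "gsum 1 g m / m \<le> harm m ^ Suc p / m" by (rule divide_right_mono) auto
    then show ?thesis by (simp add: c_def)
  qed
  then show ?thesis using pos b g0 unfolding moderate_cm_def c_def by simp
qed

text \<open>The numbers \<open>(M choose j) * bdiff q (M - j) j\<close> are the entries of the
  Hausdorff matrix of \<open>q\<close>, that is, multiplication by \<open>q\<close> seen on binomial
  transforms. The two bounds say that absolute row sums grow at most logarithmically and that little
  of their mass lies at small \<open>j\<close>.\<close>

definition null_multiplier :: "(nat \<Rightarrow> complex) \<Rightarrow> bool" where
  "null_multiplier q \<longleftrightarrow> q 0 = 0 \<and> (\<exists>C p. \<forall>M.
     (\<Sum>j\<le>M. real (M choose j) * norm (bdiff q (M - j) j)) \<le> C * harm (Suc M) ^ p \<and>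
     (\<Sum>j\<le>M. real (M choose j) * norm (bdiff q (M - j) j) / Suc j) \<le> C * harm (Suc M) ^ p / Suc M)"

lemma null_multiplier_cmult:
  assumes "null_multiplier q" shows "null_multiplier (\<lambda>m. c * q m)"
proof -
  obtain C p where C: "\<And>M. (\<Sum>j\<le>M. real (M choose j) * norm (bdiff q (M - j) j)) \<le> C * harm (Suc M) ^ p"
     "\<And>M. (\<Sum>j\<le>M. real (M choose j) * norm (bdiff q (M - j) j) / Suc j) \<le> C * harm (Suc M) ^ p / Suc M"
    using assms unfolding null_multiplier_def by blast
  have "(\<Sum>j\<le>M. real (M choose j) * norm (bdiff (\<lambda>m. c * q m) (M - j) j)) \<le> (norm c * C) * harm (Suc M) ^ p"
    for M
    using mult_left_mono[OF C(1)[of M], of "norm c"]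
    by (simp add: bdiff_cmult norm_mult sum_distrib_left mult_ac)
  moreover have "(\<Sum>j\<le>M. real (M choose j) * norm (bdiff (\<lambda>m. c * q m) (M - j) j) / Suc j)
      \<le> (norm c * C) * harm (Suc M) ^ p / Suc M" for M
    using mult_left_mono[OF C(2)[of M], of "norm c"]
    by (simp add: bdiff_cmult norm_mult sum_distrib_left mult_ac)
  ultimately show ?thesis using assms unfolding null_multiplier_def by (auto simp del: of_nat_Suc)
qed

lemma null_multiplier_add:
  assumes "null_multiplier q" "null_multiplier q'" shows "null_multiplier (\<lambda>m. q m + q' m)"
proof -
  obtain C p where C: "\<And>M. (\<Sum>j\<le>M. real (M choose j) * norm (bdiff q (M - j) j)) \<le> C * harm (Suc M) ^ p"
     "\<And>M. (\<Sum>j\<le>M. real (M choose j) * norm (bdiff q (M - j) j) / Suc j) \<le> C * harm (Suc M) ^ p / Suc M"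
    using assms unfolding null_multiplier_def by blast
  obtain C' p' where C': "\<And>M. (\<Sum>j\<le>M. real (M choose j) * norm (bdiff q' (M - j) j)) \<le> C' * harm (Suc M) ^ p'"
     "\<And>M. (\<Sum>j\<le>M. real (M choose j) * norm (bdiff q' (M - j) j) / Suc j) \<le> C' * harm (Suc M) ^ p' / Suc M"
    using assms unfolding null_multiplier_def by blast
  define D where "D = \<bar>C\<bar> + \<bar>C'\<bar>"
  have D: "C * harm (Suc M) ^ p + C' * harm (Suc M) ^ p' \<le> D * harm (Suc M) ^ (p + p')" for M
  proof -
    have h: "harm (Suc M) ^ i \<ge> (0::real)" for i by (intro zero_le_power harm_nonneg)
    have "C * harm (Suc M) ^ p \<le> \<bar>C\<bar> * harm (Suc M) ^ p"
      using h by (intro mult_right_mono) auto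
    also have "\<dots> \<le> \<bar>C\<bar> * harm (Suc M) ^ (p + p')"
      by (intro mult_left_mono harm_power_le) auto
    finally have 1: "C * harm (Suc M) ^ p \<le> \<bar>C\<bar> * harm (Suc M) ^ (p + p')" .
    have "C' * harm (Suc M) ^ p' \<le> \<bar>C'\<bar> * harm (Suc M) ^ p'"
      using h by (intro mult_right_mono) auto
    also have "\<dots> \<le> \<bar>C'\<bar> * harm (Suc M) ^ (p + p')"
      by (intro mult_left_mono harm_power_le) auto
    finally show ?thesis using 1 by (simp add: D_def algebra_simps)
  qed
  have n: "norm (bdiff (\<lambda>m. q m + q' m) i m) \<le> norm (bdiff q i m) + norm (bdiff q' i m)" for i m
    unfolding bdiff_add by (rule norm_triangle_ineq)
  have "(\<Sum>j\<le>M. real (M choose j) * norm (bdiff (\<lambda>m. q m + q' m) (M - j) j)) \<le> D * harm (Suc M) ^ (p + p')" for M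
  proof -
    have "(\<Sum>j\<le>M. real (M choose j) * norm (bdiff (\<lambda>m. q m + q' m) (M - j) j))
      \<le> (\<Sum>j\<le>M. real (M choose j) * (norm (bdiff q (M - j) j) + norm (bdiff q' (M - j) j)))"
      by (intro sum_mono mult_left_mono n) auto
    also have "\<dots> \<le> C * harm (Suc M) ^ p + C' * harm (Suc M) ^ p'"
      unfolding distrib_left sum.distrib by (intro add_mono C C')
    finally show ?thesis using D[of M] by linarith
  qed
  moreover have "(\<Sum>j\<le>M. real (M choose j) * norm (bdiff (\<lambda>m. q m + q' m) (M - j) j) / Suc j)
      \<le> D * harm (Suc M) ^ (p + p') / Suc M" for M
  proof -
    have "(\<Sum>j\<le>M. real (M choose j) * norm (bdiff (\<lambda>m. q m + q' m) (M - j) j) / Suc j)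
      \<le> (\<Sum>j\<le>M. real (M choose j) * (norm (bdiff q (M - j) j) + norm (bdiff q' (M - j) j)) / Suc j)"
      by (intro sum_mono mult_left_mono divide_right_mono n) auto
    also have "\<dots> \<le> C * harm (Suc M) ^ p / Suc M + C' * harm (Suc M) ^ p' / Suc M"
      unfolding distrib_left sum.distrib add_divide_distrib by (intro add_mono C C')
    also have "\<dots> \<le> D * harm (Suc M) ^ (p + p') / Suc M"
      unfolding add_divide_distrib[symmetric] by (intro divide_right_mono D) auto
    finally show ?thesis .
  qed
  ultimately show ?thesis using assms unfolding null_multiplier_def by (auto simp del: of_nat_Suc)
qed

text \<open>Entries off the diagonal are nonpositive, the diagonal entry \<open>q M\<close> is
  nonnegative, and each row sums to 0 because \<open>q 0 = 0\<close>. Hence the absolute row sum is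
  \<open>2 * q M\<close>.\<close>

lemma null_multiplier_moderate_cm:
  assumes "moderate_cm p g"
  shows "null_multiplier (\<lambda>m. of_real (gsum 1 g m))"
proof -
  define q where "q = gsum 1 g"
  define K where "K M j = real (M choose j) * bdiff q (M - j) j" for M j
  have g: "bdiff g i m \<ge> 0" if "m \<ge> 1" for i m
    using assms that by (auto simp: moderate_cm_def)
  have g0: "g 0 = 0" using assms by (auto simp: moderate_cm_def)
  have q0: "q 0 = 0" by (simp add: q_def g0)
  have q_Suc: "bdiff q (Suc i) m = - bdiff g i (Suc m)" for i m
    by (simp add: q_def bdiff_gsum)
  have q_pos: "q m \<ge> 0" for m
  proof -
    have "g k \<ge> 0" for k using g[of k 0] g0 by (cases "k = 0") auto
    then show ?thesis by (simp add: q_def gsum_def sum_nonneg)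
  qed
  have q_le: "q m \<le> harm (Suc m) ^ Suc p" for m
  proof -
    have "q m \<le> (\<Sum>k\<le>m. harm k ^ p / k)"
      unfolding q_def gsum_def using assms by (intro sum_mono) (auto simp: moderate_cm_def)
    also have "\<dots> \<le> harm m ^ Suc p" by (rule harm_power_sum_le)
    also have "\<dots> \<le> harm (Suc m) ^ Suc p" by (intro power_mono harm_mono harm_nonneg) auto
    finally show ?thesis .
  qed
  have absK: "real (M choose j) * \<bar>bdiff q (M - j) j\<bar> = (if j = M then 2 * q M else 0) - K M j" if "j \<le> M" for M j
  proof (cases "j = M")
    case False
    then have "M - j = Suc (M - Suc j)" using that by auto
    then obtain i where "M - j = Suc i" ..
    then have "bdiff q (M - j) j \<le> 0" using q_Suc g by simp
    then show ?thesis using False by (simp add: K_def)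
  qed (simp add: K_def q_pos)
  have sumK: "(\<Sum>j\<le>M. K M j) = 0" for M
  proof -
    have "(\<Sum>j\<le>M. K M j) = bdiff (\<lambda>m. (if m = 0 then 1 else 0) * q m) M 0"
      unfolding bdiff_leibniz bdiff_delta by (simp add: K_def)
    also have "(\<lambda>m. (if m = 0 then 1 else 0) * q m) = (\<lambda>m. 0 * q m)" using q0 by auto
    finally show ?thesis unfolding bdiff_cmult by simp
  qed
  \<comment> \<open>As \<open>1 / Suc j\<close> is the binomial transform of
    \<open>1 / Suc m\<close>, the weighted row sum is itself a difference, namely of
    \<open>q m / Suc m\<close>. The shift \<open>q1\<close> brings this into the form of
    \<open>bdiff_divide_index_at_1\<close>.\<close>
  have sumK': "(\<Sum>j\<le>M. - (K M j / Suc j)) \<le> harm (Suc M) ^ Suc p / Suc M" for M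
  proof -
    define q1 where "q1 m = q (m - 1)" for m
    have f: "bdiff (\<lambda>m. 1 / real (Suc m)) j 0 = 1 / Suc j" for j
      using bdiff_shift[of "\<lambda>m. 1 / real m" j 0] bdiff_inverse_at_1[of j] by simp
    have "(\<Sum>j\<le>M. K M j / Suc j) = bdiff (\<lambda>m. 1 / real (Suc m) * q m) M 0"
      unfolding bdiff_leibniz f by (simp add: K_def mult_ac)
    also have "(\<lambda>m. 1 / real (Suc m) * q m) = (\<lambda>m. 1 / real (Suc m) * q1 (Suc m))"
      by (simp add: q1_def)
    also have "bdiff \<dots> M 0 = bdiff (\<lambda>m. 1 / real m * q1 m) M 1"
      using bdiff_shift[of "\<lambda>m. 1 / real m * q1 m" M 0] by simp
    also have "\<dots> = (\<Sum>l\<le>M. bdiff q1 l 1) / Suc M"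
      using bdiff_divide_index_at_1[of M q1] by (simp add: field_simps)
    also have "(\<Sum>l\<le>M. bdiff q1 l 1) = (\<Sum>l\<le>M. bdiff q l 0)"
      using bdiff_shift[of q1 _ 0] by (simp add: q1_def)
    also have "\<dots> = - (\<Sum>l<M. bdiff g l 1)"
      by (cases M) (auto simp: q0 sum.atMost_Suc_shift q_Suc sum_negf lessThan_Suc_atMost
          simp del: sum.atMost_Suc bdiff.simps(2))
    finally have "(\<Sum>j\<le>M. - (K M j / Suc j)) = (\<Sum>l<M. bdiff g l 1) / Suc M"
      by (simp add: sum_negf)
    also have "\<dots> \<le> (\<Sum>l<M. harm (Suc l) ^ p / Suc l) / Suc M"
      using assms by (intro divide_right_mono sum_mono) (auto simp: moderate_cm_def)
    also have "\<dots> \<le> harm M ^ Suc p / Suc M"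
      by (intro divide_right_mono harm_power_sum_shift) auto
    also have "\<dots> \<le> harm (Suc M) ^ Suc p / Suc M"
      by (intro divide_right_mono power_mono harm_mono harm_nonneg) auto
    finally show ?thesis .
  qed
  have "(\<Sum>j\<le>M. real (M choose j) * \<bar>bdiff q (M - j) j\<bar>) \<le> 3 * harm (Suc M) ^ Suc p" for M
  proof -
    have "(\<Sum>j\<le>M. real (M choose j) * \<bar>bdiff q (M - j) j\<bar>) =
        (\<Sum>j\<le>M. (if j = M then 2 * q M else 0) - K M j)"
      by (intro sum.cong refl absK) auto
    also have "\<dots> = 2 * q M" by (simp add: sum_subtractf sumK)
    finally show ?thesis using q_le[of M] q_pos[of M] by linarith
  qed
  moreover have "(\<Sum>j\<le>M. real (M choose j) * \<bar>bdiff q (M - j) j\<bar> / Suc j)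
      \<le> 3 * harm (Suc M) ^ Suc p / Suc M" for M
  proof -
    have "(\<Sum>j\<le>M. real (M choose j) * \<bar>bdiff q (M - j) j\<bar> / Suc j) =
        (\<Sum>j\<le>M. (if j = M then 2 * q M / Suc M else 0) + - (K M j / Suc j))"
      by (intro sum.cong refl) (subst absK, auto simp: diff_divide_distrib)
    also have "\<dots> = 2 * q M / Suc M + (\<Sum>j\<le>M. - (K M j / Suc j))"
      unfolding sum.distrib by simp
    also have "\<dots> \<le> 2 * harm (Suc M) ^ Suc p / Suc M + harm (Suc M) ^ Suc p / Suc M"
      by (intro add_mono sumK' divide_right_mono mult_left_mono q_le) auto
    also have "\<dots> = 3 * harm (Suc M) ^ Suc p / Suc M"
      unfolding add_divide_distrib[symmetric] by simp
    finally show ?thesis .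
  qed
  ultimately show ?thesis using q0
    unfolding null_multiplier_def q_def[symmetric] bdiff_of_real norm_of_real
    by (intro conjI exI[of _ 3] exI[of _ "Suc p"] allI) (auto simp del: of_nat_Suc power_Suc)
qed

text \<open>The inequality of arithmetic and geometric means. With \<open>l = sqrt (Suc M)\<close>
  both bounds in \<open>null_multiplier\<close> contribute equally.\<close>

lemma inverse_sqrt_le:
  assumes "l > 0" "x > 0"
  shows "1 / sqrt x \<le> (l / x + 1 / l) / 2"
proof -
  define s where "s = sqrt x"
  have s: "s > 0" "x = s * s" using assms by (auto simp: s_def)
  have "0 \<le> (l - s) * (l - s)" by simp
  then have "2 * l * s \<le> l * l + s * s" by (simp add: algebra_simps)
  then show ?thesis unfolding s_def[symmetric] unfolding s(2) using s assms
    by (simp add: field_simps)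
qed

text \<open>By \<open>bdiff_leibniz\<close> the Hausdorff matrix of \<open>q\<close> is applied to
  the transform of \<open>v\<close>; the rate \<open>1 / sqrt (Suc j)\<close> beats the logarithmic
  growth of the rows.\<close>

lemma null_multiplier_tendsto_0:
  assumes q: "null_multiplier q" and v: "\<And>j. norm (bdiff v j 0 - L) \<le> B / sqrt (Suc j)"
  shows "(\<lambda>M. bdiff (\<lambda>m. v m * q m) M 0) \<longlonglongrightarrow> 0"
proof -
  have B: "B \<ge> 0" using order.trans[OF norm_ge_zero v[of 0]] by simp
  obtain C p where C: "\<And>M. (\<Sum>j\<le>M. real (M choose j) * norm (bdiff q (M - j) j)) \<le> C * harm (Suc M) ^ p"
     "\<And>M. (\<Sum>j\<le>M. real (M choose j) * norm (bdiff q (M - j) j) / Suc j) \<le> C * harm (Suc M) ^ p / Suc M"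
    using q unfolding null_multiplier_def by blast
  have q0: "q 0 = 0" using q by (simp add: null_multiplier_def)
  have le: "norm (bdiff (\<lambda>m. v m * q m) M 0) \<le> B * C * (harm (Suc M) ^ p / sqrt (Suc M))" for M
  proof -
    define N where "N j = real (M choose j) * norm (bdiff q (M - j) j)" for j
    define l where "l = sqrt (Suc M)"
    have l: "l > 0" "real (Suc M) = l * l" by (auto simp: l_def)
    \<comment> \<open>Subtracting \<open>L\<close> times the delta sequence leaves the product with
      \<open>q\<close> unchanged, since \<open>q 0 = 0\<close>, and lowers every binomial transform
      at 0 by \<open>L\<close>.\<close>
    define v' where "v' m = v m - L * (if m = 0 then 1 else 0)" for m
    have v': "bdiff v' j 0 = bdiff v j 0 - L" for j
      unfolding v'_def bdiff_diff bdiff_cmult bdiff_delta by simp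
    have "(\<lambda>m. v m * q m) = (\<lambda>m. v' m * q m)" using q0 by (auto simp: v'_def)
    then have "bdiff (\<lambda>m. v m * q m) M 0 =
       (\<Sum>j\<le>M. of_nat (M choose j) * (bdiff v j 0 - L) * bdiff q (M - j) j)"
      using bdiff_leibniz[of v' q M 0] by (simp add: v')
    also have "norm (\<Sum>j\<le>M. of_nat (M choose j) * (bdiff v j 0 - L) * bdiff q (M - j) j)
        \<le> (\<Sum>j\<le>M. N j * norm (bdiff v j 0 - L))"
      by (rule order.trans[OF norm_sum]) (auto simp: N_def norm_mult mult_ac intro!: sum_mono)
    also have "\<dots> \<le> (\<Sum>j\<le>M. N j * (B * ((l / Suc j + 1 / l) / 2)))"
    proof (intro sum_mono mult_left_mono)
      fix j
      have "norm (bdiff v j 0 - L) \<le> B * (1 / sqrt (Suc j))" using v[of j] by simp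
      also have "\<dots> \<le> B * ((l / Suc j + 1 / l) / 2)"
        using B l by (intro mult_left_mono inverse_sqrt_le) auto
      finally show "norm (bdiff v j 0 - L) \<le> B * ((l / Suc j + 1 / l) / 2)" .
    qed (auto simp: N_def)
    also have "\<dots> = B / 2 * (l * (\<Sum>j\<le>M. N j / Suc j) + (\<Sum>j\<le>M. N j) / l)"
      by (simp add: sum_distrib_left sum_divide_distrib sum.distrib[symmetric] algebra_simps
          add_divide_distrib del: of_nat_Suc)
    also have "\<dots> \<le> B / 2 * (l * (C * harm (Suc M) ^ p / Suc M) + C * harm (Suc M) ^ p / l)"
      using B l unfolding N_def
      by (intro mult_left_mono add_mono divide_right_mono C) auto
    also have "l * (C * harm (Suc M) ^ p / Suc M) = C * harm (Suc M) ^ p / l"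
      unfolding l(2) using l(1) by simp
    also have "B / 2 * (C * harm (Suc M) ^ p / l + C * harm (Suc M) ^ p / l) = B * C * (harm (Suc M) ^ p / l)"
      by simp
    finally show ?thesis by (simp add: l_def)
  qed
  have lim: "(\<lambda>M. B * C * (harm (Suc M) ^ p / sqrt (Suc M))) \<longlonglongrightarrow> 0"
    using tendsto_mult_right_zero[OF LIMSEQ_Suc[OF harm_power_over_sqrt_tendsto_0[of p]], of "B * C"]
    by simp
  show ?thesis by (rule Lim_null_comparison[OF always_eventually[OF allI[OF le]] lim])
qed

section \<open>The free algebra\<close>

abbreviation fs :: "nc \<Rightarrow> bool" where
  "fs P \<equiv> finite (supp P)"

abbreviation nc0 :: nc where
  "nc0 \<equiv> \<lambda>_. 0"

lemma nc_apply:
  "(P \<oplus> Q) v = P v + Q v" "(P \<ominus> Q) v = P v - Q v" "(k \<cdot> P) v = k * P v"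
  by (simp_all add: ncadd_def ncsub_def ncsmult_def)

lemma supp_wd: "supp (wd w) = {w}" by (auto simp: supp_def wd_def)

lemma fs_wd [simp]: "fs (wd w)" by (simp add: supp_wd)

lemma fs_nc0 [simp]: "fs nc0" by (simp add: supp_def)

lemma supp_add: "supp (P \<oplus> Q) \<subseteq> supp P \<union> supp Q"
  by (auto simp: supp_def nc_apply)

lemma supp_sub: "supp (P \<ominus> Q) \<subseteq> supp P \<union> supp Q"
  by (auto simp: supp_def nc_apply)

lemma supp_smult: "supp (k \<cdot> P) \<subseteq> supp P"
  by (auto simp: supp_def nc_apply)

lemma supp_mult: "supp (P \<otimes> Q) \<subseteq> (\<lambda>(u, v). u @ v) ` (supp P \<times> supp Q)"
proof
  fix w assume "w \<in> supp (P \<otimes> Q)"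
  then have "(\<Sum>i\<le>length w. P (take i w) * Q (drop i w)) \<noteq> 0"
    by (simp add: supp_def ncmult_def)
  then obtain i where "P (take i w) * Q (drop i w) \<noteq> 0"
    by (meson sum.not_neutral_contains_not_neutral)
  then show "w \<in> (\<lambda>(u, v). u @ v) ` (supp P \<times> supp Q)"
    by (intro image_eqI[of _ _ "(take i w, drop i w)"]) (auto simp: supp_def)
qed

lemma fs_add [simp]: "fs P \<Longrightarrow> fs Q \<Longrightarrow> fs (P \<oplus> Q)"
  using finite_subset[OF supp_add] by blast

lemma fs_sub [simp]: "fs P \<Longrightarrow> fs Q \<Longrightarrow> fs (P \<ominus> Q)"
  using finite_subset[OF supp_sub] by blast

lemma fs_smult [simp]: "fs P \<Longrightarrow> fs (k \<cdot> P)"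
  using finite_subset[OF supp_smult] by blast

lemma fs_mult [simp]: "fs P \<Longrightarrow> fs Q \<Longrightarrow> fs (P \<otimes> Q)"
  using finite_subset[OF supp_mult] by blast

definition spanned :: "(letter list \<Rightarrow> bool) \<Rightarrow> nc set" where
  "spanned p = {P. fs P \<and> (\<forall>w\<in>supp P. p w)}"

lemma spanned_fs: "P \<in> spanned p \<Longrightarrow> fs P" by (simp add: spanned_def)

lemma fs_iff_spanned: "fs P \<longleftrightarrow> P \<in> spanned (\<lambda>_. True)" by (simp add: spanned_def)

lemma spanned_wd [simp]: "wd w \<in> spanned p \<longleftrightarrow> p w"
  by (auto simp: spanned_def supp_wd)

lemma spanned_nc0 [simp]: "nc0 \<in> spanned p"
  by (auto simp: spanned_def supp_def)

lemma spanned_add [simp]: "P \<in> spanned p \<Longrightarrow> Q \<in> spanned p \<Longrightarrow> P \<oplus> Q \<in> spanned p"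
  using supp_add[of P Q] by (auto simp: spanned_def)

lemma spanned_sub [simp]: "P \<in> spanned p \<Longrightarrow> Q \<in> spanned p \<Longrightarrow> P \<ominus> Q \<in> spanned p"
  using supp_sub[of P Q] by (auto simp: spanned_def)

lemma spanned_smult [simp]: "P \<in> spanned p \<Longrightarrow> k \<cdot> P \<in> spanned p"
  using supp_smult[of k P] by (auto simp: spanned_def)

lemma spanned_mult:
  assumes "P \<in> spanned p" "Q \<in> spanned q" "\<And>u v. p u \<Longrightarrow> q v \<Longrightarrow> s (u @ v)"
  shows "P \<otimes> Q \<in> spanned s"
  using assms supp_mult[of P Q] by (fastforce simp: spanned_def)

lemma spanned_mono: "P \<in> spanned p \<Longrightarrow> (\<And>w. p w \<Longrightarrow> q w) \<Longrightarrow> P \<in> spanned q"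
  by (auto simp: spanned_def)

lemma spanned_induct [consumes 1, case_names zero add]:
  assumes "P \<in> spanned p" "\<phi> nc0"
    and "\<And>P w k. p w \<Longrightarrow> P \<in> spanned p \<Longrightarrow> \<phi> P \<Longrightarrow> \<phi> (P \<oplus> k \<cdot> wd w)"
  shows "\<phi> P"
proof -
  have "\<phi> P" if "finite S" "supp P \<subseteq> S" "\<forall>w\<in>S. p w" for S P
    using that
  proof (induction S arbitrary: P rule: finite_induct)
    case empty
    then have "P = nc0" by (auto simp: supp_def)
    then show ?case using assms(2) by simp
  next
    case (insert w S)
    define Q where "Q = P(w := 0)"
    have Q: "supp Q \<subseteq> S" using insert.prems by (auto simp: Q_def supp_def)
    have "P = Q \<oplus> P w \<cdot> wd w" by (auto simp: Q_def wd_def fun_eq_iff nc_apply)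
    moreover have "Q \<in> spanned p"
      using Q insert.prems insert.hyps finite_subset[OF Q] by (auto simp: spanned_def)
    ultimately show ?case using assms(3)[of w Q "P w"] insert.IH[OF Q] insert.prems by simp
  qed
  then show ?thesis using assms(1) by (auto simp: spanned_def)
qed

lemma fs_induct [consumes 1, case_names zero add]:
  assumes "fs P" "\<phi> nc0" "\<And>P w k. fs P \<Longrightarrow> \<phi> P \<Longrightarrow> \<phi> (P \<oplus> k \<cdot> wd w)"
  shows "\<phi> P"
  using assms unfolding fs_iff_spanned by (induction P rule: spanned_induct) auto

lemma mult_distribs:
  "(P \<oplus> Q) \<otimes> R = P \<otimes> R \<oplus> Q \<otimes> R" "R \<otimes> (P \<oplus> Q) = R \<otimes> P \<oplus> R \<otimes> Q"
  "(P \<ominus> Q) \<otimes> R = P \<otimes> R \<ominus> Q \<otimes> R" "R \<otimes> (P \<ominus> Q) = R \<otimes> P \<ominus> R \<otimes> Q"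
  "(k \<cdot> P) \<otimes> R = k \<cdot> (P \<otimes> R)" "R \<otimes> (k \<cdot> P) = k \<cdot> (R \<otimes> P)"
  "nc0 \<otimes> R = nc0" "R \<otimes> nc0 = nc0"
  by (auto simp: ncmult_def fun_eq_iff nc_apply sum.distrib sum_subtractf sum_distrib_left algebra_simps)

lemma mult_sum_right: "R \<otimes> (\<lambda>v. \<Sum>i\<in>S. F i v) = (\<lambda>v. \<Sum>i\<in>S. (R \<otimes> F i) v)"
  unfolding ncmult_def sum_distrib_left by (rule ext) (rule sum.swap)

lemma wd_mult_apply: "(wd u \<otimes> P) w = (if take (length u) w = u then P (drop (length u) w) else 0)"
proof -
  have "(wd u \<otimes> P) w = (\<Sum>i\<le>length w. if i = length u \<and> take i w = u then P (drop i w) else 0)"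
    unfolding ncmult_def by (intro sum.cong) (auto simp: wd_def min_def split: if_splits)
  also have "\<dots> = (\<Sum>i\<le>length w. if i = length u then (if take (length u) w = u then P (drop (length u) w) else 0) else 0)"
    by (intro sum.cong) auto
  also have "\<dots> = (if take (length u) w = u then P (drop (length u) w) else 0)"
    by (auto simp: not_le)
  finally show ?thesis .
qed

lemma mult_assoc: "(P \<otimes> Q) \<otimes> R = P \<otimes> (Q \<otimes> R)"
proof (rule ext)
  fix w :: "letter list"
  let ?n = "length w"
  let ?f = "\<lambda>j i. P (take j w) * Q (drop j (take i w)) * R (drop i w)"
  have "((P \<otimes> Q) \<otimes> R) w = (\<Sum>i\<le>?n. \<Sum>j\<le>i. ?f j i)"
    unfolding ncmult_def sum_distrib_right
    by (intro sum.cong) (auto simp: min_def)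
  also have "\<dots> = (\<Sum>j\<le>?n. \<Sum>i\<in>{j..?n}. ?f j i)"
    unfolding sum.Sigma[OF finite_atMost ballI[OF finite_atMost]]
      sum.Sigma[OF finite_atMost ballI[OF finite_atLeastAtMost]]
    by (rule sum.reindex_bij_witness[of _ "\<lambda>(a, b). (b, a)" "\<lambda>(a, b). (b, a)"]) auto
  also have "\<dots> = (P \<otimes> (Q \<otimes> R)) w"
    unfolding ncmult_def sum_distrib_left
  proof (rule sum.cong[OF refl])
    fix j assume "j \<in> {..?n}"
    show "(\<Sum>i\<in>{j..?n}. ?f j i) = (\<Sum>i\<le>length (drop j w).
       P (take j w) * (Q (take i (drop j w)) * R (drop i (drop j w))))"
      using \<open>j \<in> _\<close>
      by (intro sum.reindex_bij_witness[of _ "\<lambda>i. i + j" "\<lambda>i. i - j"]) (auto simp: drop_take mult_ac)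
  qed
  finally show "((P \<otimes> Q) \<otimes> R) w = (P \<otimes> (Q \<otimes> R)) w" .
qed

lemma wd_mult_wd: "wd u \<otimes> wd v = wd (u @ v)"
proof (rule ext)
  fix w
  have "w = u @ v \<longleftrightarrow> take (length u) w = u \<and> drop (length u) w = v"
    using append_eq_conv_conj[of u v w] by auto
  then show "(wd u \<otimes> wd v) w = wd (u @ v) w" unfolding wd_mult_apply by (simp add: wd_def)
qed

lemma wd_mult_wd_assoc: "wd u \<otimes> (wd v \<otimes> P) = wd (u @ v) \<otimes> P"
  by (simp add: mult_assoc[symmetric] wd_mult_wd)

lemma wd_Nil_mult: "wd [] \<otimes> P = P"
  by (auto simp: wd_mult_apply)

section \<open>Linear operators on finitely supported elements\<close>

lemma lin_superset:
  assumes "finite S" "supp P \<subseteq> S"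
  shows "lin f P v = (\<Sum>w\<in>S. P w * f w v)"
  unfolding lin_def using assms by (intro sum.mono_neutral_left) (auto simp: supp_def)

lemma lin_add: "fs P \<Longrightarrow> fs Q \<Longrightarrow> lin f (P \<oplus> Q) = lin f P \<oplus> lin f Q"
  by (rule ext) (simp add: lin_superset[of "supp P \<union> supp Q"] supp_add nc_apply sum.distrib algebra_simps)

lemma lin_smult: "fs P \<Longrightarrow> lin f (k \<cdot> P) = k \<cdot> lin f P"
  by (rule ext) (simp add: lin_superset[of "supp P"] supp_smult nc_apply sum_distrib_left algebra_simps)

lemma lin_wd [simp]: "lin f (wd w) = f w"
  by (rule ext) (simp add: lin_def supp_wd, simp add: wd_def)

lemma lin_nc0 [simp]: "lin f nc0 = nc0"
  by (simp add: lin_def supp_def)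

text \<open>Linearity is required only on finite support: \<open>lin\<close> sums over the support,
  and a sum over an infinite set is 0 by convention.\<close>

definition linop :: "(nc \<Rightarrow> nc) \<Rightarrow> bool" where
  "linop T \<longleftrightarrow> (\<forall>P. fs P \<longrightarrow> fs (T P)) \<and> (\<forall>P Q. fs P \<longrightarrow> fs Q \<longrightarrow> T (P \<oplus> Q) = T P \<oplus> T Q)
     \<and> (\<forall>P k. fs P \<longrightarrow> T (k \<cdot> P) = k \<cdot> T P)"

lemma linop_fs: "linop T \<Longrightarrow> fs P \<Longrightarrow> fs (T P)"
  by (simp add: linop_def)

lemma linop_add: "linop T \<Longrightarrow> fs P \<Longrightarrow> fs Q \<Longrightarrow> T (P \<oplus> Q) = T P \<oplus> T Q"
  by (simp add: linop_def)

lemma linop_smult: "linop T \<Longrightarrow> fs P \<Longrightarrow> T (k \<cdot> P) = k \<cdot> T P"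
  by (simp add: linop_def)

lemma linop_nc0: "linop T \<Longrightarrow> T nc0 = nc0"
  using linop_smult[of T nc0 0] by (simp add: ncsmult_def)

lemma sub_eq: "P \<ominus> Q = P \<oplus> (-1) \<cdot> Q"
  by (simp add: fun_eq_iff nc_apply)

lemma linop_sub: "linop T \<Longrightarrow> fs P \<Longrightarrow> fs Q \<Longrightarrow> T (P \<ominus> Q) = T P \<ominus> T Q"
  by (simp add: sub_eq linop_add linop_smult)

lemma linop_lin:
  assumes "\<And>w. fs (f w)" shows "linop (lin f)"
proof -
  have "fs (lin f P)" if "fs P" for P
    using that by (induction P rule: fs_induct) (auto simp: lin_add lin_smult assms)
  then show ?thesis by (simp add: linop_def lin_add lin_smult)
qed

lemma linop_comp: "linop S \<Longrightarrow> linop T \<Longrightarrow> linop (\<lambda>P. S (T P))"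
  by (simp add: linop_def)

lemma linop_plus: "linop S \<Longrightarrow> linop T \<Longrightarrow> linop (\<lambda>P. S P \<oplus> T P)"
  by (auto simp: linop_def fun_eq_iff nc_apply algebra_simps)

lemma linop_minus: "linop S \<Longrightarrow> linop T \<Longrightarrow> linop (\<lambda>P. S P \<ominus> T P)"
  by (auto simp: linop_def fun_eq_iff nc_apply algebra_simps)

lemma linop_scale: "linop S \<Longrightarrow> linop (\<lambda>P. k \<cdot> S P)"
  by (auto simp: linop_def fun_eq_iff nc_apply algebra_simps)

lemma linop_lmult: "fs R \<Longrightarrow> linop (\<lambda>P. R \<otimes> P)"
  by (auto simp: linop_def mult_distribs)

lemma linop_rmult: "fs R \<Longrightarrow> linop (\<lambda>P. P \<otimes> R)"
  by (auto simp: linop_def mult_distribs)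

lemma linop_eqI:
  assumes "linop S" "linop T" "\<And>w. S (wd w) = T (wd w)" "fs P"
  shows "S P = T P"
  using assms(4) by (induction P rule: fs_induct) (auto simp: linop_nc0 linop_add linop_smult assms(1-3))

lemma linop_spanned:
  assumes "linop T" "\<And>w. p w \<Longrightarrow> T (wd w) \<in> spanned q" "P \<in> spanned p"
  shows "T P \<in> spanned q"
  using assms(3) by (induction P rule: spanned_induct)
    (auto simp: linop_nc0 linop_add linop_smult assms(1,2) spanned_fs)

section \<open>The derivation \<open>d1\<close>, the map \<open>thetahat\<close> and their
  commutators\<close>

lemma fs_z [simp]: "fs z" by (simp add: z_def)

lemma fs_d1_letter [simp]: "fs (d1_letter a)"
  by (cases a) (auto simp: d1_letter_def)

lemma der_word_Cons:
  "der_word D (a # w) = D a \<otimes> wd w \<oplus> wd [a] \<otimes> der_word D w"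
proof (rule ext)
  fix v
  have "der_word D (a # w) v = ((wd [] \<otimes> D a) \<otimes> wd w) v +
     (\<Sum>i<length w. ((wd (a # take i w) \<otimes> D (w ! i)) \<otimes> wd (drop (Suc i) w)) v)"
    unfolding der_word_def by (simp add: sum.lessThan_Suc_shift del: sum.lessThan_Suc)
  also have "(\<Sum>i<length w. ((wd (a # take i w) \<otimes> D (w ! i)) \<otimes> wd (drop (Suc i) w)) v) =
     (wd [a] \<otimes> der_word D w) v"
    unfolding der_word_def mult_sum_right
    by (intro sum.cong refl) (simp add: mult_assoc wd_mult_wd_assoc)
  finally show "der_word D (a # w) v = (D a \<otimes> wd w \<oplus> wd [a] \<otimes> der_word D w) v"
    by (simp add: wd_Nil_mult nc_apply)
qed

lemma d1_wd: "d1 (wd w) = der_word d1_letter w"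
  by (simp add: d1_def der_def)

lemma d1_Nil: "d1 (wd []) = nc0"
  by (simp add: d1_wd der_word_def)

lemma d1_Cons: "d1 (wd (a # w)) = d1_letter a \<otimes> wd w \<oplus> wd [a] \<otimes> d1 (wd w)"
  by (simp add: d1_wd der_word_Cons)

lemma fs_d1_wd: "fs (d1 (wd w))"
  by (induction w) (auto simp: d1_Nil d1_Cons)

lemma linop_d1: "linop d1"
  unfolding d1_def der_def by (rule linop_lin) (simp add: d1_wd[symmetric] fs_d1_wd)

text \<open>\<open>chi\<close> is thetahat without the inner derivation \<open>P \<mapsto> (P z - z P) / 2\<close>; it keeps the span of the
  words ending in some \<open>y\<^sub>s\<close>, and \<open>psi P = chi P - z P\<close> below keeps first letters as well.\<close>

fun chi_word :: "rat \<Rightarrow> letter list \<Rightarrow> nc" where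
  "chi_word c [] = nc0"
| "chi_word c (a # w) = z \<otimes> wd (a # w) \<oplus> wd [a] \<otimes> chi_word c w \<oplus> c \<cdot> (wd [a] \<otimes> d1 (wd w))"

definition chi :: "rat \<Rightarrow> nc \<Rightarrow> nc" where
  "chi c = lin (chi_word c)"

lemma fs_chi_word: "fs (chi_word c w)"
  by (induction w) (auto simp: fs_d1_wd)

lemma linop_chi: "linop (chi c)"
  unfolding chi_def by (rule linop_lin) (rule fs_chi_word)

lemma chi_wd: "chi c (wd w) = chi_word c w"
  by (simp add: chi_def)

lemma chi_Cons:
  "chi c (wd (a # w)) = z \<otimes> wd (a # w) \<oplus> wd [a] \<otimes> chi c (wd w) \<oplus> c \<cdot> (wd [a] \<otimes> d1 (wd w))"
  by (simp add: chi_wd)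

text \<open>On a letter \<open>u\<close>, \<open>(u z + z u) / 2 = z u + (u z - z u) / 2\<close>,
  and the second summand extends to an inner derivation, which splits off along the whole word.
  \<open>Hop\<close> fixes single letters.\<close>

lemma thetahat_word_eq:
  "thetahat_word c w = chi_word c w \<oplus> (1/2) \<cdot> (wd w \<otimes> z \<ominus> z \<otimes> wd w)"
proof (induction w)
  case Nil
  have "wd [] \<otimes> z = z \<otimes> wd []"
    unfolding z_def by (simp add: mult_distribs wd_mult_wd)
  then show ?case by (simp add: fun_eq_iff nc_apply)
next
  case (Cons a w)
  have H: "Hop (wd [a]) = wd [a]" by (simp add: Hop_def ncsmult_def)
  have w: "wd (a # w) = wd [a] \<otimes> wd w" by (simp add: wd_mult_wd)
  show ?case
    unfolding thetahat_word.simps chi_word.simps Cons.IH H theta_letter_def w mult_distribs mult_assoc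
    by (rule ext) (simp add: nc_apply algebra_simps)
qed

lemma linop_thetahat: "linop (thetahat c)"
  unfolding thetahat_def by (rule linop_lin) (simp add: thetahat_word_eq fs_chi_word)

lemma thetahat_eq:
  assumes "fs P"
  shows "thetahat c P = chi c P \<oplus> (1/2) \<cdot> (P \<otimes> z \<ominus> z \<otimes> P)"
  by (rule linop_eqI[OF linop_thetahat _ _ assms])
    (auto simp: thetahat_def thetahat_word_eq chi_wd
      intro!: linop_plus linop_chi linop_scale linop_minus linop_lmult linop_rmult)

text \<open>The commutators without factorials and with the index shifted: \<open>dhat c n\<close>
  is \<open>Xop c (n - 1)\<close> divided by the factorial of \<open>n - 1\<close>.\<close>

definition Xop :: "rat \<Rightarrow> nat \<Rightarrow> nc \<Rightarrow> nc" where
  "Xop c n = (ad (thetahat c) ^^ n) d1"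

lemma Xop_0: "Xop c 0 P = d1 P" by (simp add: Xop_def)

lemma Xop_Suc: "Xop c (Suc n) P = thetahat c (Xop c n P) \<ominus> Xop c n (thetahat c P)"
  by (simp add: Xop_def ad_def)

lemma linop_Xop: "linop (Xop c n)"
proof (induction n)
  case 0
  show ?case by (simp add: Xop_def linop_d1)
next
  case (Suc n)
  show ?case unfolding Xop_Suc[abs_def]
    by (rule linop_minus[OF linop_comp[OF linop_thetahat Suc] linop_comp[OF Suc linop_thetahat]])
qed

section \<open>Evaluation along a flow\<close>

text \<open>Words are evaluated both in the complex numbers and in complex power series; the locale
  treats the two coefficient rings at once.\<close>

locale rat_hom =
  fixes \<iota> :: "rat \<Rightarrow> 'a::comm_ring_1"
  assumes hom_add: "\<iota> (x + y) = \<iota> x + \<iota> y" and hom_mult: "\<iota> (x * y) = \<iota> x * \<iota> y"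
    and hom_one: "\<iota> 1 = 1"
begin

lemma hom_zero: "\<iota> 0 = 0"
  using hom_add[of 0 0] by simp

definition lext :: "(letter list \<Rightarrow> 'a) \<Rightarrow> nc \<Rightarrow> 'a" where
  "lext \<phi> P = (\<Sum>w\<in>supp P. \<iota> (P w) * \<phi> w)"

lemma lext_superset:
  assumes "finite S" "supp P \<subseteq> S"
  shows "lext \<phi> P = (\<Sum>w\<in>S. \<iota> (P w) * \<phi> w)"
  unfolding lext_def using assms by (intro sum.mono_neutral_left) (auto simp: supp_def hom_zero)

lemma lext_add: "fs P \<Longrightarrow> fs Q \<Longrightarrow> lext \<phi> (P \<oplus> Q) = lext \<phi> P + lext \<phi> Q"
  by (simp add: lext_superset[of "supp P \<union> supp Q"] supp_add nc_apply hom_add sum.distrib algebra_simps)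

lemma lext_smult: "fs P \<Longrightarrow> lext \<phi> (k \<cdot> P) = \<iota> k * lext \<phi> P"
  by (simp add: lext_superset[of "supp P"] supp_smult nc_apply hom_mult sum_distrib_left algebra_simps)

lemma hom_minus_one: "\<iota> (-1) = -1"
proof -
  have "1 + \<iota> (-1) = 0" using hom_add[of 1 "-1"] by (simp add: hom_one hom_zero)
  then show ?thesis by (metis add_eq_0_iff)
qed

lemma lext_sub: "fs P \<Longrightarrow> fs Q \<Longrightarrow> lext \<phi> (P \<ominus> Q) = lext \<phi> P - lext \<phi> Q"
  by (simp add: sub_eq lext_add lext_smult hom_minus_one)

lemma lext_wd [simp]: "lext \<phi> (wd w) = \<phi> w"
  by (simp add: lext_def supp_wd) (simp add: wd_def hom_one)

lemma lext_nc0 [simp]: "lext \<phi> nc0 = 0"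
  by (simp add: lext_def supp_def)

end

text \<open>\<open>Y s\<close> acts by a difference so that \<open>X\<close> and \<open>Y s\<close>
  together act with the single ratio \<open>\<sigma> s\<close>. For \<open>\<sigma> 0 = 0\<close>
  this makes \<open>z\<close> multiplication by \<open>a\<close>.\<close>

definition act :: "(nat \<Rightarrow> 'a::comm_ring_1) \<Rightarrow> (nat \<Rightarrow> 'a) \<Rightarrow> letter \<Rightarrow> (nat \<Rightarrow> 'a) \<Rightarrow> nat \<Rightarrow> 'a" where
  "act \<sigma> a b f m = (case b of X \<Rightarrow> a m * gsum 1 f m
     | Y s \<Rightarrow> a m * (gsum (\<sigma> s) f m - gsum 1 f m))"

lemma nest_Cons: "nest \<sigma> a (b # w) = act \<sigma> a b (nest \<sigma> a w)"
  by (cases b) (auto simp: act_def fun_eq_iff)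

lemma gsum_add: "gsum t (\<lambda>k. f k + g k) m = gsum t f m + gsum t g m"
  by (simp add: gsum_def algebra_simps sum.distrib)

lemma gsum_diff: "gsum t (\<lambda>k. f k - g k) m = gsum t f m - gsum t g m"
  by (simp add: gsum_def algebra_simps sum_subtractf)

lemma gsum_cmult: "gsum t (\<lambda>k. c * f k) m = c * gsum t f m"
  by (simp add: gsum_def sum_distrib_left algebra_simps)

lemma gsum_minus: "gsum t (\<lambda>k. - f k) m = - gsum t f m"
  using gsum_cmult[of t "-1" f m] by simp

lemma gsum_zero_fun: "gsum t (\<lambda>k. 0) m = 0"
  by (simp add: gsum_def)

lemma act_add: "act \<sigma> a b (\<lambda>k. f k + g k) m = act \<sigma> a b f m + act \<sigma> a b g m"
  by (cases b) (auto simp: act_def gsum_add algebra_simps)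

lemma act_cmult: "act \<sigma> a b (\<lambda>k. c * f k) m = c * act \<sigma> a b f m"
  by (cases b) (auto simp: act_def gsum_cmult algebra_simps)

lemma act_zero: "act \<sigma> a b (\<lambda>k. 0) m = 0"
  by (cases b) (auto simp: act_def gsum_zero_fun)

lemma act_minus: "act \<sigma> a b (\<lambda>k. - f k) m = - act \<sigma> a b f m"
  using act_cmult[of \<sigma> a b "-1" f m] by simp

lemma act_simps:
  "act \<sigma> a X f = (\<lambda>m. a m * gsum 1 f m)"
  "act \<sigma> a (Y s) f = (\<lambda>m. a m * (gsum (\<sigma> s) f m - gsum 1 f m))"
  by (simp_all add: act_def fun_eq_iff)

lemma act_z: "\<sigma> 0 = 0 \<Longrightarrow> act \<sigma> a X f m + act \<sigma> a (Y 0) f m = a m * f m"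
  by (simp add: act_def gsum_zero algebra_simps)

text \<open>Both sides are the sum of \<open>t ^ (m - l) * a k * f l\<close> over
  \<open>l < k \<le> m\<close>: on the left the diagonal is removed, on the right
  \<open>h m - h l\<close> is the sum of the \<open>a k\<close>.\<close>

lemma partial_sum_gsum:
  fixes a f :: "nat \<Rightarrow> 'a::comm_ring_1"
  defines "h \<equiv> gsum 1 a"
  shows "gsum t (\<lambda>k. a k * gsum t f k) m - gsum t (\<lambda>k. a k * f k) m
    = h m * gsum t f m - gsum t (\<lambda>k. h k * f k) m"
proof (induction m)
  case (Suc m)
  have h: "h (Suc m) = h m + a (Suc m)" by (simp add: h_def gsum_Suc)
  have "gsum t (\<lambda>k. a k * gsum t f k) (Suc m) - gsum t (\<lambda>k. a k * f k) (Suc m) =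
    t * (gsum t (\<lambda>k. a k * gsum t f k) m - gsum t (\<lambda>k. a k * f k) m) + a (Suc m) * (t * gsum t f m)"
    by (simp add: gsum_Suc algebra_simps)
  also have "\<dots> = h (Suc m) * gsum t f (Suc m) - gsum t (\<lambda>k. h k * f k) (Suc m)"
    unfolding Suc.IH by (simp add: gsum_Suc h algebra_simps)
  finally show ?case .
qed (simp add: h_def)

context rat_hom
begin

definition ev :: "(nat \<Rightarrow> 'a) \<Rightarrow> (nat \<Rightarrow> 'a) \<Rightarrow> nc \<Rightarrow> nat \<Rightarrow> 'a" where
  "ev \<sigma> a P m = lext (\<lambda>w. nest \<sigma> a w m) P"

lemma ev_add: "fs P \<Longrightarrow> fs Q \<Longrightarrow> ev \<sigma> a (P \<oplus> Q) m = ev \<sigma> a P m + ev \<sigma> a Q m"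
  by (simp add: ev_def lext_add)

lemma ev_sub: "fs P \<Longrightarrow> fs Q \<Longrightarrow> ev \<sigma> a (P \<ominus> Q) m = ev \<sigma> a P m - ev \<sigma> a Q m"
  by (simp add: ev_def lext_sub)

lemma ev_smult: "fs P \<Longrightarrow> ev \<sigma> a (k \<cdot> P) m = \<iota> k * ev \<sigma> a P m"
  by (simp add: ev_def lext_smult)

lemma ev_wd [simp]: "ev \<sigma> a (wd w) m = nest \<sigma> a w m"
  by (simp add: ev_def)

lemma ev_nc0 [simp]: "ev \<sigma> a nc0 m = 0"
  by (simp add: ev_def)

lemma ev_prepend:
  assumes "fs P" shows "ev \<sigma> a (wd [b] \<otimes> P) m = act \<sigma> a b (ev \<sigma> a P) m"
  using assms
proof (induction P rule: fs_induct)
  case zero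
  show ?case by (simp add: mult_distribs act_zero ev_nc0[abs_def])
next
  case (add P w k)
  have "ev \<sigma> a (P \<oplus> k \<cdot> wd w) = (\<lambda>m. ev \<sigma> a P m + \<iota> k * nest \<sigma> a w m)"
    using add by (auto simp: ev_add ev_smult)
  then show ?case using add
    by (simp add: mult_distribs ev_add ev_smult wd_mult_wd nest_Cons act_add act_cmult)
qed

lemma ev_prepend_two:
  assumes "fs P" shows "ev \<sigma> a (wd [b, b'] \<otimes> P) m = act \<sigma> a b (act \<sigma> a b' (ev \<sigma> a P)) m"
proof -
  have "ev \<sigma> a (wd [b'] \<otimes> P) = act \<sigma> a b' (ev \<sigma> a P)"
    using assms by (auto simp: ev_prepend)
  moreover have "wd [b, b'] \<otimes> P = wd [b] \<otimes> (wd [b'] \<otimes> P)" by (simp add: wd_mult_wd_assoc)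
  ultimately show ?thesis using assms by (simp add: ev_prepend)
qed

lemma ev_z_left:
  assumes "fs P" "\<sigma> 0 = 0" shows "ev \<sigma> a (z \<otimes> P) m = a m * ev \<sigma> a P m"
  using assms by (simp add: z_def mult_distribs ev_add ev_prepend act_z)

text \<open>A rightmost \<open>z\<close> multiplies the delta sequence by \<open>a\<close>, which
  vanishes at 0.\<close>

lemma ev_z_right:
  assumes "fs P" "\<sigma> 0 = 0" "a 0 = 0" shows "ev \<sigma> a (P \<otimes> z) m = 0"
proof -
  have *: "nest \<sigma> a (w @ [X]) m + nest \<sigma> a (w @ [Y 0]) m = 0" for w m
  proof (induction w arbitrary: m)
    case Nil
    show ?case using act_z[of \<sigma> a "nest \<sigma> a []" m] assms(2,3) by (simp add: nest_Cons del: nest.simps(2,3))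
  next
    case (Cons b w)
    show ?case using Cons by (simp add: nest_Cons act_add[symmetric] act_zero)
  qed
  show ?thesis using assms(1)
  proof (induction P rule: fs_induct)
    case (add P w k)
    then show ?case using *[of w m]
      by (simp add: mult_distribs ev_add ev_smult) (simp add: z_def mult_distribs wd_mult_wd ev_add)
  qed (simp add: mult_distribs)
qed

text \<open>\<open>d1\<close> of a letter acts as the commutator of that letter with multiplication
  by \<open>h\<close>. This is \<open>partial_sum_gsum\<close> with ratio 1 for \<open>X\<close> and
  with the ratios \<open>\<sigma> s\<close> and 1 for \<open>Y s\<close>.\<close>

lemma ev_d1_letter:
  fixes a :: "nat \<Rightarrow> 'a"
  defines "h \<equiv> gsum 1 a"
  assumes "fs P" "\<sigma> 0 = 0"
  shows "ev \<sigma> a (d1_letter b \<otimes> P) m =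
    act \<sigma> a b (\<lambda>k. h k * ev \<sigma> a P k) m - h m * act \<sigma> a b (ev \<sigma> a P) m"
proof -
  let ?f = "ev \<sigma> a P"
  have p: "gsum t (\<lambda>k. a k * gsum t ?f k) m - gsum t (\<lambda>k. a k * ?f k) m
    = h m * gsum t ?f m - gsum t (\<lambda>k. h k * ?f k) m" for t m
    unfolding h_def by (rule partial_sum_gsum)
  show ?thesis
  proof (cases b)
    case X
    have "ev \<sigma> a (d1_letter b \<otimes> P) m = act \<sigma> a X (act \<sigma> a (Y 0) ?f) m"
      using assms(2) X by (simp add: d1_letter_def ev_prepend_two)
    also have "\<dots> = a m * (gsum 1 (\<lambda>k. a k * ?f k) m - gsum 1 (\<lambda>k. a k * gsum 1 ?f k) m)"
      using assms(3) by (simp add: act_simps gsum_zero gsum_diff right_diff_distrib)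
    also have "\<dots> = a m * - (h m * gsum 1 ?f m - gsum 1 (\<lambda>k. h k * ?f k) m)"
      unfolding p[symmetric] by (simp add: algebra_simps)
    finally show ?thesis using X by (simp add: act_def algebra_simps)
  next
    case (Y s)
    let ?s = "\<sigma> s"
    have "ev \<sigma> a (d1_letter b \<otimes> P) m = act \<sigma> a (Y s) (act \<sigma> a (Y 0) ?f) m
       - act \<sigma> a X (act \<sigma> a (Y s) ?f) m - act \<sigma> a (Y s) (act \<sigma> a (Y s) ?f) m"
      using assms(2) Y by (simp add: d1_letter_def mult_distribs ev_sub ev_prepend_two)
    also have "\<dots> = a m * ((gsum ?s (\<lambda>k. a k * ?f k) m - gsum ?s (\<lambda>k. a k * gsum ?s ?f k) m)
        - (gsum 1 (\<lambda>k. a k * ?f k) m - gsum 1 (\<lambda>k. a k * gsum 1 ?f k) m))"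
      using assms(3) by (simp add: act_simps gsum_zero gsum_diff right_diff_distrib)
    also have "\<dots> = a m * (- (h m * gsum ?s ?f m - gsum ?s (\<lambda>k. h k * ?f k) m)
        + (h m * gsum 1 ?f m - gsum 1 (\<lambda>k. h k * ?f k) m))"
      unfolding p[symmetric] by (simp add: algebra_simps)
    finally show ?thesis using Y by (simp add: act_def algebra_simps)
  qed
qed

text \<open>The commutators with \<open>h\<close> telescope along a word. The remaining inner term
  is \<open>h\<close> times the delta sequence, which is 0 because
  \<open>h 0 = a 0 = 0\<close>.\<close>

lemma ev_d1:
  assumes "fs P" "\<sigma> 0 = 0" "a 0 = 0"
  shows "ev \<sigma> a (d1 P) m = - gsum 1 a m * ev \<sigma> a P m"
proof -
  have *: "ev \<sigma> a (d1 (wd w)) m = - gsum 1 a m * nest \<sigma> a w m" for w m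
  proof (induction w arbitrary: m)
    case Nil
    show ?case using assms(3) by (simp add: d1_Nil)
  next
    case (Cons b w)
    then have IH: "ev \<sigma> a (d1 (wd w)) = (\<lambda>m. - (gsum 1 a m * nest \<sigma> a w m))" by auto
    have e: "ev \<sigma> a (wd w) = nest \<sigma> a w" by auto
    show ?case using assms(2)
      by (simp add: d1_Cons ev_add fs_d1_wd ev_d1_letter ev_prepend IH act_minus nest_Cons e)
  qed
  show ?thesis using assms(1)
  proof (induction P rule: fs_induct)
    case zero
    show ?case by (simp add: linop_nc0[OF linop_d1])
  next
    case (add P w k)
    then show ?case using *
      by (simp add: linop_add[OF linop_d1] linop_smult[OF linop_d1] linop_fs[OF linop_d1] ev_add ev_smult
        algebra_simps)
  qed
qed

end

section \<open>Evaluation in power series and the flow of the sequence \<open>a\<close>\<close>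

interpretation cev: rat_hom "of_rat :: rat \<Rightarrow> complex"
  by standard (simp_all add: of_rat_add of_rat_mult)

interpretation fev: rat_hom "\<lambda>x. fps_const (of_rat x :: complex)"
  by standard (simp_all add: of_rat_add of_rat_mult fps_const_add fps_const_mult)

text \<open>Coefficients of the power series solution of \<open>a\<^sub>j' = a\<^sub>j\<^sup>2 - c a\<^sub>j (a\<^sub>0 + \<dots> + a\<^sub>j)\<close>.\<close>

fun flow_coeff :: "complex \<Rightarrow> (nat \<Rightarrow> complex) \<Rightarrow> nat \<Rightarrow> nat \<Rightarrow> complex" where
  "flow_coeff c a 0 j = a j"
| "flow_coeff c a (Suc n) j = ((\<Sum>i\<le>n. flow_coeff c a i j * flow_coeff c a (n - i) j)
     - c * (\<Sum>i\<le>n. flow_coeff c a i j * (\<Sum>l\<le>j. flow_coeff c a (n - i) l))) / of_nat (Suc n)"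

definition flow :: "complex \<Rightarrow> (nat \<Rightarrow> complex) \<Rightarrow> nat \<Rightarrow> complex fps" where
  "flow c a j = Abs_fps (\<lambda>n. flow_coeff c a n j)"

lemma flow_nth: "fps_nth (flow c a j) n = flow_coeff c a n j"
  by (simp add: flow_def)

lemma flow_nth_0 [simp]: "fps_nth (flow c a j) 0 = a j"
  by (simp add: flow_def)

lemma gsum_1: "gsum 1 f m = (\<Sum>k\<le>m. f k)"
  by (simp add: gsum_def)

lemma flow_deriv:
  "fps_deriv (flow c a j) = flow c a j * flow c a j - fps_const c * (flow c a j * gsum 1 (flow c a) j)"
proof (rule fps_ext)
  fix n
  have "fps_nth (fps_deriv (flow c a j)) n = of_nat (Suc n) * flow_coeff c a (Suc n) j"
    by (simp add: flow_def)
  also have "\<dots> = (\<Sum>i\<le>n. flow_coeff c a i j * flow_coeff c a (n - i) j)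
     - c * (\<Sum>i\<le>n. flow_coeff c a i j * (\<Sum>l\<le>j. flow_coeff c a (n - i) l))"
    by (simp del: of_nat_Suc)
  also have "\<dots> = fps_nth (flow c a j * flow c a j - fps_const c * (flow c a j * gsum 1 (flow c a) j)) n"
  proof -
    have G: "fps_nth (gsum 1 (flow c a) j) i = (\<Sum>l\<le>j. flow_coeff c a i l)" for i
      by (simp add: gsum_1 fps_sum_nth flow_nth)
    have "fps_nth (flow c a j * g) n = (\<Sum>i\<le>n. flow_coeff c a i j * fps_nth g (n - i))" for g
      by (simp add: fps_mult_nth flow_def atLeast0AtMost)
    then show ?thesis
      using G by (simp add: flow_nth)
  qed
  finally show "fps_nth (fps_deriv (flow c a j)) n =
    fps_nth (flow c a j * flow c a j - fps_const c * (flow c a j * gsum 1 (flow c a) j)) n" .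
qed

lemma flow_0:
  assumes "a 0 = 0" shows "flow c a 0 = 0"
proof -
  have "flow_coeff c a n 0 = 0" for n
  proof (induction n rule: less_induct)
    case (less n)
    then show ?case using assms by (cases n) auto
  qed
  then show ?thesis by (simp add: flow_def fps_ext)
qed

lemma fps_deriv_gsum:
  "fps_deriv (gsum (fps_const t) f m) = gsum (fps_const t) (\<lambda>k. fps_deriv (f k)) m"
  by (induction m) (simp_all add: gsum_Suc)

locale harmonic_flow =
  fixes c :: rat and \<sigma> :: "nat \<Rightarrow> complex" and a :: "nat \<Rightarrow> complex fps"
  assumes \<sigma>_0: "\<sigma> 0 = 0" and a_0: "a 0 = 0"
    and deriv_a: "fps_deriv (a j) = a j * a j - fps_const (of_rat c) * (a j * gsum 1 a j)"
begin

abbreviation "\<sigma>' \<equiv> \<lambda>s. fps_const (\<sigma> s)"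

lemma fps_deriv_gsum_1: "fps_deriv (gsum 1 f m) = gsum 1 (\<lambda>k. fps_deriv (f k)) m"
  using fps_deriv_gsum[of 1 f m] by simp

text \<open>The ratios are constants, so the commutator of differentiation with a letter comes from
  the prefactor \<open>a m\<close> alone, whose derivative is \<open>a m\<close> times
  \<open>a m - c h m\<close>.\<close>

lemma fps_deriv_act:
  "fps_deriv (act \<sigma>' a b f m) =
    (a m - fps_const (of_rat c) * gsum 1 a m) * act \<sigma>' a b f m + act \<sigma>' a b (\<lambda>k. fps_deriv (f k)) m"
  by (cases b) (simp_all add: act_def deriv_a fps_deriv_gsum_1 fps_deriv_gsum algebra_simps)

text \<open>In the induction the term with \<open>z\<close> contributes \<open>a m\<close>, and the
  term with \<open>d1\<close> cancels \<open>c h\<close> inside the letter. By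
  \<open>fps_deriv_act\<close> the outer \<open>c h\<close> cancels as well, and the two sides
  agree.\<close>

lemma ev_chi:
  assumes "fs P"
  shows "fev.ev \<sigma>' a (chi c P) m = fps_deriv (fev.ev \<sigma>' a P m) +
     fps_const (of_rat c) * gsum 1 a m * fev.ev \<sigma>' a P m"
proof -
  have *: "fev.ev \<sigma>' a (chi c (wd w)) m = fps_deriv (nest \<sigma>' a w m) +
     fps_const (of_rat c) * (gsum 1 a m * nest \<sigma>' a w m)" for w m
  proof (induction w arbitrary: m)
    case Nil
    show ?case using a_0 by (simp add: chi_wd)
  next
    case (Cons b w)
    let ?f = "nest \<sigma>' a w"
    from Cons have IH: "fev.ev \<sigma>' a (chi c (wd w)) = (\<lambda>k. fps_deriv (?f k) +
         fps_const (of_rat c) * (gsum 1 a k * ?f k))" by auto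
    have D: "fev.ev \<sigma>' a (d1 (wd w)) = (\<lambda>k. - (gsum 1 a k * ?f k))"
      using fev.ev_d1[of "wd w" \<sigma>' a] \<sigma>_0 a_0 by auto
    have "fev.ev \<sigma>' a (chi c (wd (b # w))) m = a m * act \<sigma>' a b ?f m +
       (act \<sigma>' a b (\<lambda>k. fps_deriv (?f k)) m + fps_const (of_rat c) * act \<sigma>' a b (\<lambda>k. gsum 1 a k * ?f k) m) -
       fps_const (of_rat c) * act \<sigma>' a b (\<lambda>k. gsum 1 a k * ?f k) m"
      unfolding chi_Cons using \<sigma>_0
      by (simp add: fev.ev_add fev.ev_smult fev.ev_prepend fev.ev_z_left linop_fs[OF linop_chi] fs_d1_wd
          IH D act_add act_cmult act_minus nest_Cons)
    also have "\<dots> = fps_deriv (nest \<sigma>' a (b # w) m) +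
     fps_const (of_rat c) * (gsum 1 a m * nest \<sigma>' a (b # w) m)"
      unfolding nest_Cons fps_deriv_act by (simp add: algebra_simps)
    finally show ?case .
  qed
  show ?thesis using assms(1)
  proof (induction P rule: fs_induct)
    case zero
    show ?case by (simp add: linop_nc0[OF linop_chi])
  next
    case (add P w k)
    then show ?case using *[of w m]
      by (simp add: linop_add[OF linop_chi] linop_smult[OF linop_chi] linop_fs[OF linop_chi]
        fev.ev_add fev.ev_smult algebra_simps)
  qed
qed

lemma ev_thetahat:
  assumes "fs P"
  shows "fev.ev \<sigma>' a (thetahat c P) m = fps_deriv (fev.ev \<sigma>' a P m) +
     (fps_const (of_rat c) * gsum 1 a m - fps_const (1/2) * a m) * fev.ev \<sigma>' a P m"
proof -
  have h: "of_rat (1/2) = (1/2 :: complex)" by (simp add: of_rat_divide)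
  show ?thesis
  unfolding thetahat_eq[OF assms(1)] using assms
  by (simp add: fev.ev_add fev.ev_sub fev.ev_smult fev.ev_z_left fev.ev_z_right linop_fs[OF linop_chi]
      ev_chi \<sigma>_0 a_0 h algebra_simps)
qed

text \<open>Multiplication operators commute, so of \<open>thetahat\<close> only the differentiation
  enters the commutator, and its commutator with multiplication by a series is multiplication by the
  derivative.\<close>

lemma ev_Xop:
  assumes "fs P"
  shows "fev.ev \<sigma>' a (Xop c n P) m = (fps_deriv ^^ n) (- gsum 1 a m) * fev.ev \<sigma>' a P m"
  using assms(1)
proof (induction n arbitrary: P)
  case 0
  then show ?case using \<sigma>_0 a_0 by (simp add: Xop_0 fev.ev_d1)
next
  case (Suc n)
  show ?case
    using Suc.prems
    by (simp add: Xop_Suc fev.ev_sub linop_fs[OF linop_Xop] linop_fs[OF linop_thetahat] ev_thetahat Suc.IH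
      algebra_simps)
qed

text \<open>A class closed under differentiation whose generating operations, at constant terms
  \<open>1 / m\<close>, become those under which \<open>moderate_cm\<close> is closed: division by
  the index and averaged partial sums.\<close>

inductive hspan :: "(nat \<Rightarrow> complex fps) \<Rightarrow> bool" where
  hspan_base: "hspan a"
| hspan_add: "hspan f \<Longrightarrow> hspan g \<Longrightarrow> hspan (\<lambda>m. f m + g m)"
| hspan_cmult: "hspan f \<Longrightarrow> hspan (\<lambda>m. fps_const k * f m)"
| hspan_x: "hspan f \<Longrightarrow> hspan (\<lambda>m. a m * gsum 1 f m)"
| hspan_z: "hspan f \<Longrightarrow> hspan (\<lambda>m. a m * f m)"

lemma hspan_minus: "hspan f \<Longrightarrow> hspan (\<lambda>m. - f m)"
  using hspan_cmult[of f "-1"] by (simp flip: fps_const_neg)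

lemma hspan_diff: "hspan f \<Longrightarrow> hspan g \<Longrightarrow> hspan (\<lambda>m. f m - g m)"
  using hspan_add[OF _ hspan_minus, of f g] by simp

text \<open>The derivative of \<open>a\<close> contains the product with \<open>gsum 1 a\<close>,
  which is not among the generating operations; \<open>partial_sum_gsum\<close> reduces it to
  them.\<close>

lemma hspan_mult_sum: "hspan f \<Longrightarrow> hspan (\<lambda>m. gsum 1 a m * f m)"
proof (induction rule: hspan.induct)
  case hspan_base
  show ?case using hspan_x[OF hspan.hspan_base] by (simp add: mult.commute)
next
  case (hspan_add f g)
  then show ?case using hspan.hspan_add by (simp add: distrib_left)
next
  case (hspan_cmult f k)
  then show ?case using hspan.hspan_cmult[OF hspan_cmult.IH, of k] by (simp add: mult.left_commute)
next
  case (hspan_x f)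
  have "gsum 1 a m * (a m * gsum 1 f m) = a m * gsum 1 (\<lambda>k. gsum 1 a k * f k) m
     + a m * gsum 1 (\<lambda>k. a k * gsum 1 f k) m - a m * gsum 1 (\<lambda>k. a k * f k) m" for m
    using arg_cong[OF partial_sum_gsum[of 1 a f m], of "\<lambda>x. a m * x"] by (simp add: algebra_simps)
  moreover have "hspan (\<lambda>m. a m * gsum 1 (\<lambda>k. gsum 1 a k * f k) m
     + a m * gsum 1 (\<lambda>k. a k * gsum 1 f k) m - a m * gsum 1 (\<lambda>k. a k * f k) m)"
    using hspan_x by (intro hspan_diff hspan.hspan_add hspan.hspan_x hspan.hspan_z)
  ultimately show ?case by simp
next
  case (hspan_z f)
  then show ?case using hspan.hspan_z[OF hspan_z.IH] by (simp add: mult.left_commute)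
qed

lemma hspan_deriv: "hspan f \<Longrightarrow> hspan (\<lambda>m. fps_deriv (f m))"
proof (induction rule: hspan.induct)
  case hspan_base
  have "hspan (\<lambda>m. a m * a m - fps_const (of_rat c) * (gsum 1 a m * a m))"
    by (intro hspan_diff hspan.intros hspan_mult_sum)
  then show ?case by (simp add: deriv_a mult.commute)
next
  case (hspan_add f g)
  then show ?case using hspan.hspan_add by simp
next
  case (hspan_cmult f k)
  then show ?case using hspan.hspan_cmult by simp
next
  case (hspan_x f)
  have "hspan (\<lambda>m. a m * gsum 1 (\<lambda>k. fps_deriv (f k)) m + (a m * (a m * gsum 1 f m)
      - fps_const (of_rat c) * (gsum 1 a m * (a m * gsum 1 f m))))"
    using hspan_x by (intro hspan_diff hspan.intros hspan_mult_sum)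
  then show ?case by (simp add: deriv_a fps_deriv_gsum_1 algebra_simps)
next
  case (hspan_z f)
  have "hspan (\<lambda>m. a m * fps_deriv (f m) + (a m * (a m * f m)
      - fps_const (of_rat c) * (gsum 1 a m * (a m * f m))))"
    using hspan_z by (intro hspan_diff hspan.intros hspan_mult_sum)
  then show ?case by (simp add: deriv_a algebra_simps)
qed

lemma deriv_power_sum: "\<exists>f. hspan f \<and> (\<forall>m. (fps_deriv ^^ n) (- gsum 1 a m) = gsum 1 f m)"
proof (induction n)
  case 0
  show ?case by (intro exI[of _ "\<lambda>m. - a m"]) (simp add: hspan_minus hspan_base gsum_minus)
next
  case (Suc n)
  then obtain f where "hspan f" "\<forall>m. (fps_deriv ^^ n) (- gsum 1 a m) = gsum 1 f m" by blast
  then show ?case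
    by (intro exI[of _ "\<lambda>m. fps_deriv (f m)"]) (simp add: fps_deriv_gsum_1 hspan_deriv)
qed

end

text \<open>Complex combinations destroy positivity and may mix exponents \<open>p\<close>, but the
  property \<open>null_multiplier\<close> of the partial sums survives them.\<close>

inductive nspan :: "(nat \<Rightarrow> complex) \<Rightarrow> bool" where
  nspan_base: "moderate_cm p g \<Longrightarrow> nspan (\<lambda>m. of_real (g m))"
| nspan_add: "nspan f \<Longrightarrow> nspan g \<Longrightarrow> nspan (\<lambda>m. f m + g m)"
| nspan_cmult: "nspan f \<Longrightarrow> nspan (\<lambda>m. k * f m)"

lemma gsum_of_real: "gsum 1 (\<lambda>m. of_real (g m)) m = (of_real (gsum 1 g m) :: complex)"
  by (simp add: gsum_1)

lemma nspan_cesaro: "nspan f \<Longrightarrow> nspan (\<lambda>m. 1 / of_nat m * gsum 1 f m)"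
proof (induction rule: nspan.induct)
  case (nspan_base p g)
  show ?case using nspan.nspan_base[OF moderate_cm_cesaro[OF nspan_base]] by (simp add: gsum_of_real)
next
  case (nspan_add f g)
  then show ?case using nspan.nspan_add[OF nspan_add.IH] by (simp add: gsum_add add_divide_distrib)
next
  case (nspan_cmult f k)
  then show ?case using nspan.nspan_cmult[OF nspan_cmult.IH, of k] by (simp add: gsum_cmult)
qed

lemma nspan_divide: "nspan f \<Longrightarrow> nspan (\<lambda>m. 1 / of_nat m * f m)"
proof (induction rule: nspan.induct)
  case (nspan_base p g)
  show ?case using nspan.nspan_base[OF moderate_cm_divide[OF nspan_base]] by simp
next
  case (nspan_add f g)
  then show ?case using nspan.nspan_add[OF nspan_add.IH] by (simp add: add_divide_distrib)
next
  case (nspan_cmult f k)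
  then show ?case using nspan.nspan_cmult[OF nspan_cmult.IH, of k] by simp
qed

lemma nspan_null_multiplier: "nspan f \<Longrightarrow> null_multiplier (gsum 1 f)"
proof (induction rule: nspan.induct)
  case (nspan_base p g)
  show ?case using null_multiplier_moderate_cm[OF nspan_base] by (simp add: gsum_of_real[abs_def])
next
  case (nspan_add f g)
  then show ?case using null_multiplier_add[OF nspan_add.IH] by (simp add: gsum_add[abs_def])
next
  case (nspan_cmult f k)
  then show ?case using null_multiplier_cmult[OF nspan_cmult.IH, of k] by (simp add: gsum_cmult[abs_def])
qed

lemma (in harmonic_flow) hspan_nspan:
  assumes "\<And>m. fps_nth (a m) 0 = 1 / of_nat m"
  shows "hspan f \<Longrightarrow> nspan (\<lambda>m. fps_nth (f m) 0)"
proof (induction rule: hspan.induct)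
  case hspan_base
  show ?case using nspan_base[OF moderate_cm_inverse] by (simp add: assms)
next
  case (hspan_add f g)
  then show ?case using nspan_add by simp
next
  case (hspan_cmult f k)
  then show ?case using nspan_cmult by simp
next
  case (hspan_x f)
  then show ?case using nspan_cesaro[OF hspan_x.IH] by (simp add: assms gsum_1 fps_sum_nth)
next
  case (hspan_z f)
  then show ?case using nspan_divide[OF hspan_z.IH] by (simp add: assms)
qed

lemma (in harmonic_flow) null_multiplier_deriv_power:
  assumes "\<And>m. fps_nth (a m) 0 = 1 / of_nat m"
  shows "null_multiplier (\<lambda>m. fps_nth ((fps_deriv ^^ n) (- gsum 1 a m)) 0)"
proof -
  obtain f where f: "hspan f" "\<And>m. (fps_deriv ^^ n) (- gsum 1 a m) = gsum 1 f m"
    using deriv_power_sum by blast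
  have "fps_nth (gsum 1 f m) 0 = gsum 1 (\<lambda>k. fps_nth (f k) 0) m" for m
    by (simp add: gsum_1 fps_sum_nth)
  then show ?thesis
    using nspan_null_multiplier[OF hspan_nspan[OF assms f(1)]] unfolding f(2) by simp
qed

section \<open>Stability of convergent words\<close>

lemma d1_prepend:
  assumes "fs P" shows "d1 (wd [b] \<otimes> P) = d1_letter b \<otimes> P \<oplus> wd [b] \<otimes> d1 P"
  by (rule linop_eqI[OF linop_comp[OF linop_d1 linop_lmult]
      linop_plus[OF linop_lmult linop_comp[OF linop_lmult linop_d1]] _ assms])
    (simp_all add: wd_mult_wd d1_Cons)

lemma chi_prepend:
  assumes "fs P"
  shows "chi c (wd [b] \<otimes> P) = z \<otimes> (wd [b] \<otimes> P) \<oplus> wd [b] \<otimes> chi c P \<oplus> c \<cdot> (wd [b] \<otimes> d1 P)"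
  by (rule linop_eqI[OF linop_comp[OF linop_chi linop_lmult]
      linop_plus[OF linop_plus[OF linop_comp[OF linop_lmult linop_lmult] linop_comp[OF linop_lmult linop_chi]]
        linop_scale[OF linop_comp[OF linop_lmult linop_d1]]] _ assms])
    (simp_all add: wd_mult_wd chi_Cons)

lemma wd_Cons_mult: "wd (b # w) \<otimes> P = wd [b] \<otimes> (wd w \<otimes> P)"
  by (simp add: wd_mult_wd_assoc)

lemma mult_wd_Nil: "P \<otimes> wd [] = P"
proof (rule ext)
  fix v
  have "(P \<otimes> wd []) v = (\<Sum>i\<le>length v. if i = length v then P v else 0)"
    unfolding ncmult_def by (intro sum.cong) (auto simp: wd_def)
  then show "(P \<otimes> wd []) v = P v" by simp
qed

lemma d1_z: "d1 z = nc0"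
proof -
  have "d1 z = d1 (wd [X]) \<oplus> d1 (wd [Y 0])" by (simp add: z_def linop_add[OF linop_d1])
  also have "\<dots> = nc0"
    unfolding d1_Cons d1_Nil mult_distribs mult_wd_Nil
    by (rule ext) (simp add: d1_letter_def nc_apply)
  finally show ?thesis .
qed

lemma chi_z: "chi c z = z \<otimes> z"
proof -
  have "chi c (wd [b]) = z \<otimes> wd [b]" for b
    unfolding chi_wd chi_word.simps d1_Nil mult_distribs by (rule ext) (simp add: nc_apply)
  then have "chi c z = z \<otimes> wd [X] \<oplus> z \<otimes> wd [Y 0]"
    by (simp add: z_def linop_add[OF linop_chi])
  then show ?thesis unfolding mult_distribs[symmetric] z_def[symmetric] .
qed

lemma d1_right_z:
  assumes "fs P" shows "d1 (P \<otimes> z) = d1 P \<otimes> z"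
proof -
  have "d1 (wd w \<otimes> z) = d1 (wd w) \<otimes> z" for w
  proof (induction w)
    case Nil
    show ?case by (simp add: wd_Nil_mult d1_z d1_Nil mult_distribs)
  next
    case (Cons b w)
    show ?case unfolding wd_Cons_mult[of b w z] using Cons
      by (simp add: d1_prepend d1_Cons mult_distribs mult_assoc)
  qed
  then show ?thesis
    by (intro linop_eqI[OF linop_comp[OF linop_d1 linop_rmult] linop_comp[OF linop_rmult linop_d1] _ assms]) auto
qed

lemma chi_right_z:
  assumes "fs P" shows "chi c (P \<otimes> z) = chi c P \<otimes> z \<oplus> P \<otimes> (z \<otimes> z)"
proof -
  have "chi c (wd w \<otimes> z) = chi c (wd w) \<otimes> z \<oplus> wd w \<otimes> (z \<otimes> z)" for w
  proof (induction w)
    case Nil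
    have "chi c (wd []) = nc0" by (simp add: chi_wd)
    then show ?case unfolding wd_Nil_mult chi_z by (simp add: mult_distribs fun_eq_iff nc_apply)
  next
    case (Cons b w)
    have w: "wd (b # w) = wd [b] \<otimes> wd w" by (simp add: wd_mult_wd)
    have "chi c (wd (b # w) \<otimes> z) = z \<otimes> (wd [b] \<otimes> (wd w \<otimes> z)) \<oplus>
       wd [b] \<otimes> (chi c (wd w) \<otimes> z \<oplus> wd w \<otimes> (z \<otimes> z)) \<oplus> c \<cdot> (wd [b] \<otimes> (d1 (wd w) \<otimes> z))"
      unfolding wd_Cons_mult[of b w z] using Cons by (simp add: chi_prepend d1_right_z)
    also have "\<dots> = chi c (wd (b # w)) \<otimes> z \<oplus> wd (b # w) \<otimes> (z \<otimes> z)"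
      unfolding w chi_prepend[OF fs_wd] mult_distribs mult_assoc
      by (rule ext) (simp add: nc_apply)
    finally show ?case .
  qed
  then show ?thesis
    by (intro linop_eqI[OF linop_comp[OF linop_chi linop_rmult]
          linop_plus[OF linop_comp[OF linop_rmult linop_chi] linop_rmult] _ assms]) auto
qed

lemma thetahat_right_z:
  assumes "fs P" shows "thetahat c (P \<otimes> z) = thetahat c P \<otimes> z \<oplus> P \<otimes> (z \<otimes> z)"
proof -
  have "fs (P \<otimes> z)" using assms by simp
  show ?thesis
    unfolding thetahat_eq[OF assms] thetahat_eq[OF \<open>fs (P \<otimes> z)\<close>] chi_right_z[OF assms] mult_distribs mult_assoc
    by (rule ext) (simp add: nc_apply algebra_simps)
qed

text \<open>\<open>thetahat\<close> commutes with right multiplication by \<open>z\<close> up to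
  right multiplication by \<open>z \<otimes> z\<close>, and this extra term cancels in the next
  commutator.\<close>

lemma Xop_right_z: "fs P \<Longrightarrow> Xop c n (P \<otimes> z) = Xop c n P \<otimes> z"
proof (induction n arbitrary: P)
  case 0
  then show ?case by (simp add: Xop_0 d1_right_z)
next
  case (Suc n)
  have *: "Xop c n (P \<otimes> (z \<otimes> z)) = Xop c n P \<otimes> (z \<otimes> z)"
    using Suc by (simp add: mult_assoc[symmetric])
  have "Xop c (Suc n) (P \<otimes> z) = (thetahat c (Xop c n P) \<otimes> z \<oplus> Xop c n P \<otimes> (z \<otimes> z))
      \<ominus> (Xop c n (thetahat c P) \<otimes> z \<oplus> Xop c n P \<otimes> (z \<otimes> z))"
    unfolding Xop_Suc using Suc
    by (simp add: thetahat_right_z linop_fs[OF linop_Xop] linop_fs[OF linop_thetahat]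
        linop_add[OF linop_Xop] *)
  also have "\<dots> = Xop c (Suc n) P \<otimes> z"
    unfolding Xop_Suc mult_distribs by (rule ext) (simp add: nc_apply)
  finally show ?case .
qed

text \<open>Right multiplication by \<open>z\<close> would create words ending in \<open>X\<close>.
  It drops out of the commutator by \<open>Xop_right_z\<close>, leaving only operators that preserve
  the span of words ending in some \<open>Y s\<close>.\<close>

lemma Xop_Suc_commutator:
  assumes "fs P"
  shows "Xop c (Suc n) P = (chi c (Xop c n P) \<ominus> Xop c n (chi c P))
    \<ominus> (1/2) \<cdot> (z \<otimes> Xop c n P \<ominus> Xop c n (z \<otimes> P))"
proof -
  have f: "fs (Xop c n P)" using linop_fs[OF linop_Xop] assms by blast
  have "Xop c n (thetahat c P) = Xop c n (chi c P) \<oplus> (1/2) \<cdot> (Xop c n P \<otimes> z \<ominus> Xop c n (z \<otimes> P))"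
    unfolding thetahat_eq[OF assms] using assms
    by (simp add: linop_add[OF linop_Xop] linop_smult[OF linop_Xop] linop_sub[OF linop_Xop]
      linop_fs[OF linop_chi] Xop_right_z)
  then show ?thesis
    unfolding Xop_Suc thetahat_eq[OF f] by (intro ext) (simp add: nc_apply algebra_simps)
qed

section \<open>Words ending in some \<open>Y s\<close> and convergent words\<close>

definition valid_word :: "nat \<Rightarrow> letter list \<Rightarrow> bool" where
  "valid_word r w \<longleftrightarrow> (\<forall>a\<in>set w. valid_letter r a)"

definition validY :: "nat \<Rightarrow> letter list \<Rightarrow> bool" where
  "validY r w \<longleftrightarrow> valid_word r w \<and> ends_Y w"

text \<open>The nonempty convergent words, in a form that exposes the first letter as the recursions
  for \<open>chi\<close> and \<open>d1\<close> do.\<close>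

definition validC :: "nat \<Rightarrow> letter list \<Rightarrow> bool" where
  "validC r w \<longleftrightarrow> (\<exists>b u. w = b # u \<and> valid_letter r b \<and> b \<noteq> Y 0 \<and> validY r u)"

lemma validC_iff: "validC r w \<longleftrightarrow> valid_word r w \<and> conv_word w \<and> w \<noteq> []"
proof (cases w)
  case (Cons b u)
  show ?thesis unfolding Cons
    by (cases b; cases u)
      (auto simp: validC_def validY_def valid_word_def conv_word_def ends_Y_def)
qed (simp add: validC_def)

lemma validC_validY: "validC r w \<Longrightarrow> validY r w"
  by (auto simp: validC_def validY_def valid_word_def ends_Y_def)

lemma validY_append: "valid_word r u \<Longrightarrow> validY r v \<Longrightarrow> validY r (u @ v)"
  by (auto simp: validY_def valid_word_def ends_Y_def)

lemma d1_letter_spanned: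
  assumes "valid_letter r b" "r > 0"
  shows "d1_letter b \<in> spanned (validY r)"
  using assms by (cases b) (auto simp: d1_letter_def validY_def valid_word_def valid_letter_def ends_Y_def)

lemma validY_valid_word: "validY r w \<Longrightarrow> valid_word r w"
  by (simp add: validY_def)

lemma d1_spanned_word:
  assumes "validY r w" "r > 0" shows "d1 (wd w) \<in> spanned (validY r)"
  using assms(1)
proof (induction w)
  case (Cons b w)
  have b: "d1_letter b \<in> spanned (validY r)"
    using Cons.prems assms(2) by (intro d1_letter_spanned) (auto simp: validY_def valid_word_def)
  show ?case
  proof (cases "w = []")
    case True
    then show ?thesis using b by (simp add: d1_Cons d1_Nil mult_wd_Nil mult_distribs)
  next
    case False
    then have w: "validY r w" and b': "valid_word r [b]"
      using Cons.prems by (auto simp: validY_def valid_word_def ends_Y_def)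
    have "d1_letter b \<otimes> wd w \<in> spanned (validY r)"
      by (rule spanned_mult[OF b, of _ "validY r"])
        (use w in \<open>auto intro: validY_append validY_valid_word\<close>)
    moreover have "wd [b] \<otimes> d1 (wd w) \<in> spanned (validY r)"
      by (rule spanned_mult[of _ "valid_word r", OF _ Cons.IH[OF w]]) (use b' in \<open>auto intro: validY_append\<close>)
    ultimately show ?thesis by (simp add: d1_Cons)
  qed
qed (simp add: validY_def ends_Y_def)

lemma z_spanned: "r > 0 \<Longrightarrow> z \<in> spanned (valid_word r)"
  by (simp add: z_def valid_word_def valid_letter_def)

lemma z_mult_spanned: "r > 0 \<Longrightarrow> P \<in> spanned (validY r) \<Longrightarrow> z \<otimes> P \<in> spanned (validY r)"
  by (rule spanned_mult[OF z_spanned, where q = "validY r"]) (auto intro: validY_append)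

lemma chi_spanned_word:
  assumes "validY r w" "r > 0" shows "chi c (wd w) \<in> spanned (validY r)"
  using assms(1)
proof (induction w)
  case (Cons b w)
  have 1: "z \<otimes> wd (b # w) \<in> spanned (validY r)"
    using Cons.prems assms(2) by (intro z_mult_spanned) auto
  show ?case
  proof (cases "w = []")
    case True
    then show ?thesis using 1 by (simp add: chi_Cons d1_Nil mult_distribs) (simp add: chi_wd mult_distribs)
  next
    case False
    then have w: "validY r w" and b': "valid_word r [b]"
      using Cons.prems by (auto simp: validY_def valid_word_def ends_Y_def)
    have "wd [b] \<otimes> P \<in> spanned (validY r)" if "P \<in> spanned (validY r)" for P
      by (rule spanned_mult[of _ "valid_word r", OF _ that]) (use b' in \<open>auto intro: validY_append\<close>)
    then show ?thesis using 1 Cons.IH[OF w] d1_spanned_word[OF w assms(2)] by (simp add: chi_Cons)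
  qed
qed (simp add: validY_def ends_Y_def)

lemma d1_spanned: "r > 0 \<Longrightarrow> P \<in> spanned (validY r) \<Longrightarrow> d1 P \<in> spanned (validY r)"
  by (rule linop_spanned[OF linop_d1]) (auto intro: d1_spanned_word)

lemma chi_spanned: "r > 0 \<Longrightarrow> P \<in> spanned (validY r) \<Longrightarrow> chi c P \<in> spanned (validY r)"
  by (rule linop_spanned[OF linop_chi]) (auto intro: chi_spanned_word)

lemma Xop_spanned:
  assumes "r > 0" "P \<in> spanned (validY r)"
  shows "Xop c n P \<in> spanned (validY r)"
  using assms(2)
proof (induction n arbitrary: P)
  case 0
  then show ?case using assms(1) by (simp add: Xop_0 d1_spanned)
next
  case (Suc n)
  then show ?case unfolding Xop_Suc_commutator[OF spanned_fs[OF Suc.prems]] using assms(1)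
    by (intro spanned_sub spanned_smult chi_spanned z_mult_spanned Suc.IH)
qed

definition psi :: "rat \<Rightarrow> nc \<Rightarrow> nc" where
  "psi c P = chi c P \<ominus> z \<otimes> P"

lemma linop_psi: "linop (psi c)"
  unfolding psi_def[abs_def] by (intro linop_minus linop_chi linop_lmult fs_z)

lemma validC_Cons: "valid_letter r b \<Longrightarrow> b \<noteq> Y 0 \<Longrightarrow> validY r u \<Longrightarrow> validC r (b # u)"
  by (auto simp: validC_def)

lemma prepend_spanned_validC:
  assumes "valid_letter r b" "b \<noteq> Y 0" "P \<in> spanned (validY r)"
  shows "wd [b] \<otimes> P \<in> spanned (validC r)"
  by (rule spanned_mult[of _ "\<lambda>u. u = [b]", OF _ assms(3)]) (use assms(1,2) in \<open>auto intro!: validC_Cons\<close>)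

text \<open>Subtracting \<open>z \<otimes> P\<close> removes the only term of \<open>chi\<close>
  that changes the first letter.\<close>

lemma psi_spanned:
  assumes "r > 0" "P \<in> spanned (validC r)" shows "psi c P \<in> spanned (validC r)"
proof (rule linop_spanned[OF linop_psi _ assms(2)])
  fix w assume "validC r w"
  then obtain b u where w: "w = b # u" "valid_letter r b" "b \<noteq> Y 0" "validY r u"
    by (auto simp: validC_def)
  have "psi c (wd w) = wd [b] \<otimes> (chi c (wd u) \<oplus> c \<cdot> d1 (wd u))"
    unfolding psi_def w(1) chi_Cons mult_distribs by (rule ext) (simp add: nc_apply)
  then show "psi c (wd w) \<in> spanned (validC r)"
    using w assms(1) by (simp add: prepend_spanned_validC chi_spanned_word d1_spanned_word)
qed

text \<open>The words in \<open>d1_letter (Y s)\<close> begin with \<open>Y s\<close> or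
  \<open>X\<close>, so for \<open>s \<noteq> 0\<close> the letter \<open>Y 0\<close> never comes
  first.\<close>

lemma d1_spanned_validC:
  assumes "r > 0" "P \<in> spanned (validC r)" shows "d1 P \<in> spanned (validC r)"
proof (rule linop_spanned[OF linop_d1 _ assms(2)])
  fix w assume "validC r w"
  then obtain b u where w: "w = b # u" "valid_letter r b" "b \<noteq> Y 0" "validY r u"
    by (auto simp: validC_def)
  have "d1_letter b \<in> spanned (\<lambda>v. \<exists>b' v'. v = b' # v' \<and> valid_letter r b' \<and> b' \<noteq> Y 0 \<and> valid_word r v')"
    using w(2,3) assms(1) by (cases b) (auto simp: d1_letter_def valid_letter_def valid_word_def)
  then have "d1_letter b \<otimes> wd u \<in> spanned (validC r)"
    by (rule spanned_mult[of _ _ _ "validY r"]) (use w(4) in \<open>auto intro!: validC_Cons validY_append\<close>)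
  then show "d1 (wd w) \<in> spanned (validC r)"
    unfolding w(1) d1_Cons using w assms(1) by (simp add: prepend_spanned_validC d1_spanned_word)
qed

text \<open>By \<open>comm\<close> the terms with \<open>z\<close> in
  \<open>Xop_Suc_commutator\<close> vanish and \<open>chi\<close> may be replaced by
  \<open>psi\<close>, which preserves convergent words.\<close>

lemma Xop_spanned_validC:
  assumes "r > 0" "P \<in> spanned (validC r)"
    and comm: "\<And>n Q. Q \<in> spanned (validY r) \<Longrightarrow> Xop c n (z \<otimes> Q) = z \<otimes> Xop c n Q"
  shows "Xop c n P \<in> spanned (validC r)"
  using assms(2)
proof (induction n arbitrary: P)
  case 0
  then show ?case using assms(1) by (simp add: Xop_0 d1_spanned_validC)
next
  case (Suc n)
  have P: "P \<in> spanned (validY r)" using Suc.prems by (rule spanned_mono) (rule validC_validY)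
  have "Xop c (Suc n) P = psi c (Xop c n P) \<ominus> Xop c n (psi c P)"
    unfolding Xop_Suc_commutator[OF spanned_fs[OF Suc.prems]] psi_def using spanned_fs[OF P]
    by (simp add: linop_sub[OF linop_Xop] linop_fs[OF linop_chi] comm[OF P])
      (rule ext, simp add: nc_apply algebra_simps)
  then show ?case using Suc assms(1) by (simp add: psi_spanned)
qed

section \<open>Faithfulness of the evaluation\<close>

text \<open>Linear independence of exponentials: subtracting \<open>\<tau> j\<close> times the
  relation at \<open>m\<close> from the one at \<open>Suc m\<close> eliminates the index
  \<open>j\<close>.\<close>

lemma power_sums_eq_0_imp:
  fixes C \<tau> :: "'b \<Rightarrow> complex"
  assumes "finite S" "inj_on \<tau> S" "\<forall>i\<in>S. \<tau> i \<noteq> 0" "\<forall>m>K. (\<Sum>i\<in>S. C i * \<tau> i ^ m) = 0"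
  shows "\<forall>i\<in>S. C i = 0"
  using assms
proof (induction S arbitrary: C rule: finite_induct)
  case (insert j S)
  have "(\<Sum>i\<in>S. (C i * (\<tau> i - \<tau> j)) * \<tau> i ^ m) = 0" if "m > K" for m
  proof -
    have "(\<Sum>i\<in>S. C i * \<tau> i ^ Suc m) + C j * \<tau> j ^ Suc m = 0"
      using insert.prems(3)[rule_format, of "Suc m"] insert.hyps that
      by (simp add: add.commute del: power_Suc)
    moreover have "(\<Sum>i\<in>S. C i * \<tau> i ^ m) + C j * \<tau> j ^ m = 0"
      using insert.prems(3) insert.hyps that by (simp add: add.commute)
    moreover have "(\<Sum>i\<in>S. C i * \<tau> i ^ Suc m) - \<tau> j * (\<Sum>i\<in>S. C i * \<tau> i ^ m) =
        ((\<Sum>i\<in>S. C i * \<tau> i ^ Suc m) + C j * \<tau> j ^ Suc m)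
        - \<tau> j * ((\<Sum>i\<in>S. C i * \<tau> i ^ m) + C j * \<tau> j ^ m)"
      by (simp add: algebra_simps)
    ultimately have "(\<Sum>i\<in>S. C i * \<tau> i ^ Suc m) - \<tau> j * (\<Sum>i\<in>S. C i * \<tau> i ^ m) = 0"
      by simp
    then show ?thesis by (simp add: sum_distrib_left sum_subtractf algebra_simps)
  qed
  then have "\<forall>i\<in>S. C i * (\<tau> i - \<tau> j) = 0"
    using insert.prems by (intro insert.IH) auto
  moreover have "\<tau> i \<noteq> \<tau> j" if "i \<in> S" for i
    using insert.prems(1) insert.hyps that by (auto simp: inj_on_def)
  ultimately have S: "\<forall>i\<in>S. C i = 0" by auto
  moreover have "C j * \<tau> j ^ Suc K = 0"
    using insert.prems(3)[rule_format, of "Suc K"] insert.hyps S by simp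
  ultimately show ?case using insert.prems(2) by auto
qed auto

definition lder :: "letter \<Rightarrow> nc \<Rightarrow> nc" where
  "lder b P = (\<lambda>w. P (b # w))"

lemma fs_lder: "fs P \<Longrightarrow> fs (lder b P)"
  by (rule finite_surj[of "supp P" _ tl]) (force simp: supp_def lder_def)+

lemma lder_add_wd: "lder b (P \<oplus> k \<cdot> wd w) =
   (if w \<noteq> [] \<and> hd w = b then lder b P \<oplus> k \<cdot> wd (tl w) else lder b P)"
  by (cases w) (auto simp: lder_def fun_eq_iff nc_apply wd_def)

lemma ev_decomp:
  assumes "P \<in> spanned (valid_word r)"
  shows "cev.ev \<sigma> a P m = of_rat (P []) * (if m = 0 then 1 else 0) +
    act \<sigma> a X (cev.ev \<sigma> a (lder X P)) m + (\<Sum>s<r. act \<sigma> a (Y s) (cev.ev \<sigma> a (lder (Y s) P)) m)"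
  using assms
proof (induction P rule: spanned_induct)
  case zero
  have "lder b nc0 = nc0" for b by (simp add: lder_def)
  then show ?case by (simp add: cev.ev_nc0[abs_def] act_zero)
next
  case (add P w k)
  have fs: "fs P" by (rule spanned_fs[OF add.hyps(2)])
  have up: "cev.ev \<sigma> a (lder b P \<oplus> k \<cdot> wd u) = (\<lambda>m. cev.ev \<sigma> a (lder b P) m + of_rat k * nest \<sigma> a u m)" for b u
    using fs by (auto simp: cev.ev_add cev.ev_smult fs_lder)
  have ev: "cev.ev \<sigma> a (P \<oplus> k \<cdot> wd w) m = cev.ev \<sigma> a P m + of_rat k * nest \<sigma> a w m"
    using fs by (simp add: cev.ev_add cev.ev_smult)
  show ?case
  proof (cases w)
    case Nil
    then show ?thesis unfolding ev add.IH lder_add_wd by (simp add: nc_apply wd_def of_rat_add algebra_simps)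
  next
    case (Cons b u)
    show ?thesis
    proof (cases b)
      case X
      have c: "(P \<oplus> k \<cdot> wd w) [] = P []" using Cons by (simp add: nc_apply wd_def)
      have "act \<sigma> a X (cev.ev \<sigma> a (lder X (P \<oplus> k \<cdot> wd w))) m =
          act \<sigma> a X (cev.ev \<sigma> a (lder X P)) m + of_rat k * nest \<sigma> a w m"
        using Cons X by (simp add: lder_add_wd up act_add act_cmult nest_Cons del: nest.simps)
      moreover have "lder (Y s) (P \<oplus> k \<cdot> wd w) = lder (Y s) P" for s
        using Cons X by (simp add: lder_add_wd)
      ultimately show ?thesis unfolding ev add.IH c by simp
    next
      case (Y t)
      have t: "t < r" using add.hyps(1) Cons Y by (simp add: valid_word_def valid_letter_def)
      have c: "(P \<oplus> k \<cdot> wd w) [] = P []" using Cons by (simp add: nc_apply wd_def)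
      have "act \<sigma> a (Y s) (cev.ev \<sigma> a (lder (Y s) (P \<oplus> k \<cdot> wd w))) m =
          act \<sigma> a (Y s) (cev.ev \<sigma> a (lder (Y s) P)) m + (if s = t then of_rat k * nest \<sigma> a w m else 0)" for s
        using Cons Y by (auto simp: lder_add_wd up act_add act_cmult nest_Cons simp del: nest.simps)
      moreover have "lder X (P \<oplus> k \<cdot> wd w) = lder X P"
        using Cons Y by (simp add: lder_add_wd)
      ultimately show ?thesis unfolding ev add.IH c using t by (simp add: sum.distrib)
    qed
  qed
qed

section \<open>Dependence of the evaluation on the sequence \<open>a\<close>\<close>

lemma ev_at_0:
  assumes "P \<in> spanned (valid_word r)" "a 0 = 0"
  shows "cev.ev \<sigma> a P 0 = of_rat (P [])"
  unfolding ev_decomp[OF assms(1)] using assms(2) by (simp add: act_simps)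

lemma nest_cong: "(\<And>i. i \<le> k \<Longrightarrow> a i = a' i) \<Longrightarrow> nest \<sigma> a w k = nest \<sigma> a' w k"
proof (induction w arbitrary: k)
  case (Cons b w)
  have "gsum t (nest \<sigma> a w) k = gsum t (nest \<sigma> a' w) k" for t
    unfolding gsum_def using Cons by (intro sum.cong) auto
  then show ?case using Cons.prems by (cases b) auto
qed simp

lemma nest_eq_0: "a k = 0 \<Longrightarrow> k \<noteq> 0 \<Longrightarrow> nest \<sigma> a w k = 0"
  by (cases "(\<sigma>, a, w)" rule: nest.cases) auto

lemma continuous_nest:
  fixes \<sigma> a :: "nat \<Rightarrow> complex"
  shows "continuous_on UNIV (\<lambda>\<epsilon>. nest \<sigma> (a(j := \<epsilon>)) w k)"
proof (induction w arbitrary: k)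
  case (Cons b w)
  have a: "continuous_on UNIV (\<lambda>\<epsilon>. (a(j := \<epsilon>)) k)"
    by (cases "k = j") (auto intro!: continuous_intros)
  show ?case
    by (cases b) (auto simp: gsum_def intro!: continuous_intros a Cons simp del: fun_upd_apply)
qed auto

lemma continuous_ev:
  "continuous_on UNIV (\<lambda>\<epsilon>. cev.ev \<sigma> (a(j := \<epsilon>)) P k)"
  unfolding cev.ev_def cev.lext_def by (intro continuous_intros continuous_nest)

lemma ev_cong: "(\<And>i. i \<le> k \<Longrightarrow> a i = a' i) \<Longrightarrow> cev.ev \<sigma> a P k = cev.ev \<sigma> a' P k"
  unfolding cev.ev_def by (simp cong: nest_cong)

lemma ev_eq_0: "a k = 0 \<Longrightarrow> k \<noteq> 0 \<Longrightarrow> cev.ev \<sigma> a P k = 0"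
  unfolding cev.ev_def cev.lext_def by (simp add: nest_eq_0)

lemma continuous_zero_extension:
  fixes g :: "complex \<Rightarrow> complex"
  assumes "continuous_on UNIV g" "\<And>\<epsilon>. \<epsilon> \<noteq> 0 \<Longrightarrow> g \<epsilon> = 0"
  shows "g 0 = 0"
proof -
  have "(g \<longlongrightarrow> g 0) (at 0)" using assms(1) by (simp add: continuous_on_def)
  moreover have "(g \<longlongrightarrow> 0) (at 0)"
    by (rule tendsto_eventually) (auto simp: eventually_at_filter assms(2))
  ultimately show ?thesis using tendsto_unique[of "at (0::complex)"] by auto
qed

lemma nc_sum_Suc: fixes n :: nat shows "(\<lambda>w. \<Sum>s<Suc n. R s w) = (\<lambda>w. \<Sum>s<n. R s w) \<oplus> R n"
  by (simp add: fun_eq_iff nc_apply)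

lemma spanned_sum: fixes n :: nat shows "(\<And>s. s < n \<Longrightarrow> R s \<in> spanned p) \<Longrightarrow> (\<lambda>w. \<Sum>s<n. R s w) \<in> spanned p"
proof (induction n)
  case (Suc n)
  then show ?case unfolding nc_sum_Suc by (intro spanned_add) auto
qed simp

lemma ev_sum: fixes n :: nat shows "(\<And>s. s < n \<Longrightarrow> fs (R s)) \<Longrightarrow>
   cev.ev \<sigma> a (\<lambda>w. \<Sum>s<n. R s w) m = (\<Sum>s<n. cev.ev \<sigma> a (R s) m)"
proof (induction n)
  case (Suc n)
  have "fs (\<lambda>w. \<Sum>s<n. R s w)"
    using Suc.prems spanned_sum[of n R "\<lambda>_. True"] by (simp add: fs_iff_spanned)
  then show ?case unfolding nc_sum_Suc using Suc by (simp add: cev.ev_add)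
qed simp

lemma partial_sums_eq_0_imp:
  fixes u :: "nat \<Rightarrow> 'b::ab_group_add"
  assumes "\<And>K. (\<Sum>k\<le>K. u k) = 0" shows "u K = 0"
  using assms[of K] assms[of "K - 1"] by (cases K) auto

definition faithful_class :: "nat \<Rightarrow> nat \<Rightarrow> letter list \<Rightarrow> bool" where
  "faithful_class r N w \<longleftrightarrow> valid_word r w \<and> (w = [] \<or> ends_Y w) \<and> length w \<le> N"

lemma faithful_class_valid: "P \<in> spanned (faithful_class r N) \<Longrightarrow> P \<in> spanned (valid_word r)"
  by (erule spanned_mono) (simp add: faithful_class_def)

lemma lder_faithful_class:
  assumes "P \<in> spanned (faithful_class r (Suc N))"
  shows "lder b P \<in> spanned (faithful_class r N)"
proof -
  have "faithful_class r N w" if "P (b # w) \<noteq> 0" for w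
  proof -
    have "faithful_class r (Suc N) (b # w)" using that assms by (auto simp: spanned_def supp_def)
    then show ?thesis by (auto simp: faithful_class_def valid_word_def ends_Y_def split: if_splits)
  qed
  then show ?thesis using fs_lder[OF spanned_fs[OF assms], of b]
    by (auto simp: spanned_def supp_def lder_def)
qed

text \<open>Split \<open>P\<close> by first letters and cancel the outer factor \<open>a m\<close>.
  For a truncated sequence the relation is an exponential sum in \<open>m\<close>, whose
  coefficients force the evaluations of the left quotients of \<open>P\<close> to vanish; these are
  covered by induction.\<close>

lemma ev_faithful:
  fixes \<sigma> :: "nat \<Rightarrow> complex"
  assumes "r > 0" and \<sigma>0: "\<sigma> 0 = 0" and inj: "inj_on \<sigma> {..<r}" and \<sigma>1: "\<And>s. s < r \<Longrightarrow> \<sigma> s \<noteq> 1"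
    and "P \<in> spanned (faithful_class r N)" "\<And>a m. a 0 = 0 \<Longrightarrow> cev.ev \<sigma> a P m = 0"
  shows "P = nc0"
  using assms(5,6)
proof (induction N arbitrary: P)
  case 0
  have "P [] = 0" using ev_at_0[OF faithful_class_valid[OF 0(1)], of "\<lambda>_. 0" \<sigma>] 0(2)[of "\<lambda>_. 0" 0] by simp
  moreover have "P w = 0" if "w \<noteq> []" for w
    using 0(1) that by (auto simp: spanned_def supp_def faithful_class_def)
  ultimately show ?case by (metis ext)
next
  case (Suc N)
  define R where "R s = lder (Y s) P" for s
  \<comment> \<open>\<open>Q\<close> collects the contributions of ratio 1 from all letters, so that
    each \<open>R s\<close> appears with ratio \<open>\<sigma> s\<close> only.\<close>
  define Q where "Q = lder X P \<ominus> (\<lambda>w. \<Sum>s<r. R s w)"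
  have R: "R s \<in> spanned (faithful_class r N)" for s
    unfolding R_def by (rule lder_faithful_class[OF Suc.prems(1)])
  have PX: "lder X P \<in> spanned (faithful_class r N)"
    by (rule lder_faithful_class[OF Suc.prems(1)])
  have Q: "Q \<in> spanned (faithful_class r N)"
    unfolding Q_def by (intro spanned_sub spanned_sum PX R)
  have fsR: "fs (R s)" for s using spanned_fs[OF R] .
  have fsS: "fs (\<lambda>w. \<Sum>s<r. R s w)" by (rule spanned_fs[OF spanned_sum[OF R]])
  have P0: "P [] = 0"
    using ev_at_0[OF faithful_class_valid[OF Suc.prems(1)], of "\<lambda>_. 0" \<sigma>] Suc.prems(2)[of "\<lambda>_. 0" 0] by simp
  define F where "F a m = gsum 1 (cev.ev \<sigma> a Q) m + (\<Sum>s<r. gsum (\<sigma> s) (cev.ev \<sigma> a (R s)) m)" for a m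
  have evQ: "cev.ev \<sigma> a Q = (\<lambda>m. cev.ev \<sigma> a (lder X P) m - (\<Sum>s<r. cev.ev \<sigma> a (R s) m))" for a
    unfolding Q_def using spanned_fs[OF PX] fsS by (auto simp: cev.ev_sub ev_sum fsR)
  have gsum_sum: "gsum 1 (\<lambda>m. \<Sum>s<r. f s m) m = (\<Sum>s<r. gsum 1 (f s) m)" for f :: "nat \<Rightarrow> nat \<Rightarrow> complex" and m
    unfolding gsum_1 by (rule sum.swap)
  have aF: "a m * F a m = 0" if "a 0 = 0" for a m
  proof -
    have "a m * F a m = act \<sigma> a X (cev.ev \<sigma> a (lder X P)) m + (\<Sum>s<r. act \<sigma> a (Y s) (cev.ev \<sigma> a (R s)) m)"
      unfolding F_def evQ gsum_diff gsum_sum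
      by (simp add: act_simps sum_distrib_left sum_subtractf algebra_simps)
    also have "\<dots> = cev.ev \<sigma> a P m"
      unfolding ev_decomp[OF faithful_class_valid[OF Suc.prems(1)]] R_def P0 by simp
    finally show ?thesis using Suc.prems(2)[of a m] that by simp
  qed
  \<comment> \<open>Where \<open>a m = 0\<close>, \<open>aF\<close> says nothing; the entry is then
    perturbed, and continuity gives the value at 0.\<close>
  have F0: "F a m = 0" if "a 0 = 0" "m \<ge> 1" for a m
  proof (cases "a m = 0")
    case True
    have "F (a(m := \<epsilon>)) m = 0" if "\<epsilon> \<noteq> 0" for \<epsilon>
      using aF[of "a(m := \<epsilon>)" m] \<open>a 0 = 0\<close> \<open>m \<ge> 1\<close> that by auto
    moreover have "continuous_on UNIV (\<lambda>\<epsilon>. F (a(m := \<epsilon>)) m)"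
      unfolding F_def gsum_def by (intro continuous_intros continuous_ev)
    ultimately have "F (a(m := 0)) m = 0" by (rule continuous_zero_extension[rotated])
    then show ?thesis using True by (metis fun_upd_triv)
  qed (use aF[of a m] that in auto)
  \<comment> \<open>The ratio \<open>\<sigma> 0 = 0\<close> contributes nothing beyond the
    truncation point, so slot 0 is free for the ratio 1 of \<open>Q\<close>. Injectivity uses
    \<open>\<sigma> s \<noteq> 1\<close>.\<close>
  define \<tau> where "\<tau> s = (if s = 0 then 1 else \<sigma> s)" for s
  have \<sigma>_ne: "\<sigma> s \<noteq> 0" if "s < r" "s \<noteq> 0" for s
    using inj_onD[OF inj, of s 0] \<sigma>0 that \<open>r > 0\<close> by auto
  have \<tau>: "inj_on \<tau> {..<r}" "\<forall>s\<in>{..<r}. \<tau> s \<noteq> 0"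
  proof -
    show "\<forall>s\<in>{..<r}. \<tau> s \<noteq> 0" using \<sigma>_ne by (auto simp: \<tau>_def)
    show "inj_on \<tau> {..<r}"
      using \<sigma>1 by (auto simp: inj_on_def \<tau>_def dest: inj_onD[OF inj])
  qed
  define U where "U a s k = (if s = 0 then cev.ev \<sigma> a Q k else inverse (\<sigma> s) ^ k * cev.ev \<sigma> a (R s) k)" for a s k
  have U: "(\<Sum>k\<le>K. U a s k) = 0" if "a 0 = 0" "s < r" for a s K
  proof -
    \<comment> \<open>With \<open>a\<close> cut off after \<open>K\<close>, all sums stop at
      \<open>K\<close>, so for \<open>m > K\<close> the dependence on \<open>m\<close> is purely
      exponential.\<close>
    define a' where "a' j = (if j \<le> K then a j else 0)" for j
    have a'0: "a' 0 = 0" using that by (simp add: a'_def)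
    have ev': "cev.ev \<sigma> a' T k = (if k \<le> K then cev.ev \<sigma> a T k else 0)" for T k
    proof (cases "k \<le> K")
      case True
      then show ?thesis using ev_cong[of k a' a \<sigma> T] by (simp add: a'_def)
    next
      case False
      then show ?thesis using ev_eq_0[of a' k \<sigma> T] by (simp add: a'_def)
    qed
    have gs: "gsum t (cev.ev \<sigma> a' T) m = (\<Sum>k\<le>K. t ^ (m - k) * cev.ev \<sigma> a T k)" if "m > K" for t T m
      unfolding gsum_def using that by (intro sum.mono_neutral_cong_right) (auto simp: ev')
    have "(\<Sum>s<r. (\<Sum>k\<le>K. U a s k) * \<tau> s ^ m) = 0" if "m > K" for m
    proof -
      have 1: "(\<Sum>k\<le>K. U a s k) * \<tau> s ^ m = (if s = 0 then gsum 1 (cev.ev \<sigma> a' Q) m else 0)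
          + gsum (\<sigma> s) (cev.ev \<sigma> a' (R s)) m" if "s < r" for s
      proof (cases "s = 0")
        case True
        have "gsum (\<sigma> 0) (cev.ev \<sigma> a' (R 0)) m = 0"
          using \<open>m > K\<close> by (simp add: \<sigma>0 gsum_zero ev')
        then show ?thesis using True \<open>m > K\<close> by (simp add: U_def \<tau>_def gs)
      next
        case False
        have "\<sigma> s \<noteq> 0" using \<sigma>_ne that False by auto
        then have "inverse (\<sigma> s) ^ k * \<sigma> s ^ m = \<sigma> s ^ (m - k)" if "k \<le> K" for k
          using that \<open>m > K\<close> by (simp add: power_diff field_simps)
        then show ?thesis using False \<open>m > K\<close>
          by (simp add: U_def \<tau>_def gs sum_distrib_right) (intro sum.cong, auto simp: mult.commute mult.left_commute)
      qed
      have "(\<Sum>s<r. (\<Sum>k\<le>K. U a s k) * \<tau> s ^ m) = F a' m"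
        using 1 \<open>r > 0\<close> by (simp add: F_def sum.distrib)
      also have "\<dots> = 0" using F0[of a' m] a'0 that by simp
      finally show ?thesis .
    qed
    then show ?thesis using power_sums_eq_0_imp[OF _ \<tau>, of K "\<lambda>s. \<Sum>k\<le>K. U a s k"] that by auto
  qed
  have U0: "U a s k = 0" if "a 0 = 0" "s < r" for a s k
    using partial_sums_eq_0_imp[of "U a s" k] U[of a s] that by simp
  have "cev.ev \<sigma> a Q k = 0" if "a 0 = 0" for a k
    using U0[of a 0 k] that \<open>r > 0\<close> by (simp add: U_def)
  then have Q0: "Q = nc0" by (intro Suc.IH Q)
  have R0: "R s = nc0" if "0 < s" "s < r" for s
  proof (intro Suc.IH R)
    fix a :: "nat \<Rightarrow> complex" and m assume "a 0 = 0"
    moreover have "\<sigma> s \<noteq> 0" using \<sigma>_ne that by auto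
    ultimately show "cev.ev \<sigma> a (R s) m = 0" using U0[of a s m] that by (simp add: U_def)
  qed
  have sumR: "(\<Sum>s<r. f s (R s)) = f 0 (R 0)" if "\<And>s. f s nc0 = 0" for f :: "nat \<Rightarrow> nc \<Rightarrow> 'c::comm_monoid_add"
  proof -
    have "(\<Sum>s<r. f s (R s)) = (\<Sum>s<r. if s = 0 then f 0 (R 0) else 0)"
      using R0 that by (intro sum.cong) auto
    then show ?thesis using \<open>r > 0\<close> by simp
  qed
  have PXR: "P (X # w) = R 0 w" for w
  proof -
    have "Q w = 0" by (simp add: Q0)
    then show ?thesis using sumR[of "\<lambda>_ T. T w"] by (simp add: Q_def nc_apply lder_def)
  qed
  \<comment> \<open>With the other quotients gone, \<open>F a m\<close> is the evaluation of
    \<open>R 0\<close> itself for \<open>m \<ge> 1\<close>. At index 0 the value is the coefficient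
    of \<open>[X]\<close> in \<open>P\<close>, which is 0 since that word does not end in any
    \<open>Y s\<close>.\<close>
  have "R 0 = nc0"
  proof (intro Suc.IH R)
    fix a :: "nat \<Rightarrow> complex" and m assume a: "a 0 = 0"
    show "cev.ev \<sigma> a (R 0) m = 0"
    proof (cases "m = 0")
      case True
      have "P [X] = 0" using Suc.prems(1) by (auto simp: spanned_def supp_def faithful_class_def ends_Y_def)
      then show ?thesis using PXR[of "[]"] True ev_at_0[OF faithful_class_valid[OF R], of a] a by simp
    next
      case False
      have "F a m = gsum (\<sigma> 0) (cev.ev \<sigma> a (R 0)) m"
        unfolding F_def Q0
        using sumR[of "\<lambda>s T. gsum (\<sigma> s) (cev.ev \<sigma> a T) m"] by (simp add: cev.ev_nc0[abs_def] gsum_zero_fun)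
      then show ?thesis using F0[of a m] a False by (simp add: \<sigma>0 gsum_zero)
    qed
  qed
  then have Rs: "R s = nc0" if "s < r" for s using R0 that by (cases "s = 0") auto
  show ?case
  proof (rule ext)
    fix w
    show "P w = 0"
    proof (cases w)
      case Nil
      then show ?thesis using P0 by simp
    next
      case (Cons b u)
      show ?thesis
      proof (cases b)
        case X
        then show ?thesis using Cons PXR[of u] Rs[OF \<open>r > 0\<close>] by simp
      next
        case (Y s)
        show ?thesis
        proof (cases "s < r")
          case True
          then show ?thesis using Cons Y fun_cong[OF Rs[OF True], of u] by (simp add: R_def lder_def)
        next
          case False
          then have "\<not> valid_word r w" using Cons Y by (simp add: valid_word_def valid_letter_def)
          then show ?thesis using Suc.prems(1) by (auto simp: spanned_def supp_def faithful_class_def)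
        qed
      qed
    qed
  qed
qed

section \<open>The quasi-derivation relation\<close>

lemma root_nonzero: "root r s \<noteq> 0"
  using norm_root[of r s] by (metis norm_zero zero_neq_one)

lemma root_inj: "inj_on (root r) {..<r}"
proof -
  have "s = t" if "s \<le> t" "t < r" "root r s = root r t" for s t
  proof -
    have "root r t = root r (t - s) * root r s"
      using that(1) by (simp add: root_def cis_mult add_divide_distrib[symmetric] of_nat_diff algebra_simps)
    then have "root r (t - s) = 1" using that root_nonzero[of r s] by simp
    then show ?thesis using root_eq_1_iff[of "t - s" r] that by simp
  qed
  then show ?thesis unfolding inj_on_def by (metis lessThan_iff nat_le_linear)
qed

lemma gsum_fps_nth_0: "fps_nth (gsum (fps_const t) f m) 0 = gsum t (\<lambda>k. fps_nth (f k) 0) m"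
  by (induction m) (simp_all add: gsum_Suc)

lemma nest_fps_nth_0:
  "fps_nth (nest (\<lambda>s. fps_const (\<sigma> s)) a w m) 0 = nest \<sigma> (\<lambda>j. fps_nth (a j) 0) w m"
proof (induction w arbitrary: m)
  case (Cons b w)
  have 1: "fps_nth (gsum 1 f m) 0 = gsum 1 (\<lambda>k. fps_nth (f k) 0) m" for f :: "nat \<Rightarrow> 'a fps" and m
    using gsum_fps_nth_0[of 1 f m] by simp
  show ?case by (cases b) (simp_all add: gsum_fps_nth_0 1 Cons)
qed simp

lemma ev_fps_nth_0:
  "fps_nth (fev.ev (\<lambda>s. fps_const (\<sigma> s)) a P m) 0 = cev.ev \<sigma> (\<lambda>j. fps_nth (a j) 0) P m"
  by (simp add: fev.ev_def fev.lext_def cev.ev_def cev.lext_def fps_sum_nth nest_fps_nth_0)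

lemma harmonic_flow_flow:
  "\<sigma> 0 = 0 \<Longrightarrow> a 0 = 0 \<Longrightarrow> harmonic_flow c \<sigma> (flow (of_rat c) a)"
  by unfold_locales (auto simp: flow_0 flow_deriv)

text \<open>Along a flow both \<open>z\<close> and \<open>Xop c n\<close> act by multiplication, so
  they commute there. A flow can start at any \<open>a\<close> with \<open>a 0 = 0\<close>, so the
  constant terms make all evaluations of the difference vanish, and \<open>ev_faithful\<close>
  applies.\<close>

lemma Xop_left_z:
  assumes "r > 0" "Q \<in> spanned (validY r)"
  shows "Xop c n (z \<otimes> Q) = z \<otimes> Xop c n Q"
proof -
  define \<sigma> where "\<sigma> s = 1 - root r s" for s
  define D where "D = Xop c n (z \<otimes> Q) \<ominus> z \<otimes> Xop c n Q"
  have D: "D \<in> spanned (validY r)"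
    unfolding D_def using assms by (intro spanned_sub Xop_spanned z_mult_spanned)
  define N where "N = Max (length ` supp D)"
  have "length w \<le> N" if "w \<in> supp D" for w
    unfolding N_def using that spanned_fs[OF D] by (intro Max_ge) auto
  then have DN: "D \<in> spanned (faithful_class r N)"
    using D by (auto simp: spanned_def faithful_class_def validY_def)
  have fs: "fs Q" "fs (z \<otimes> Q)" "fs (Xop c n Q)" "fs (Xop c n (z \<otimes> Q))"
    using spanned_fs[OF assms(2)] by (auto intro!: linop_fs[OF linop_Xop])
  have \<sigma>0: "\<sigma> 0 = 0" by (simp add: \<sigma>_def root_def)
  have ev: "cev.ev \<sigma> a D m = 0" if a: "a 0 = 0" for a m
  proof -
    interpret harmonic_flow c \<sigma> "flow (of_rat c) a"
      using \<sigma>0 a by (rule harmonic_flow_flow)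
    have "fev.ev \<sigma>' (flow (of_rat c) a) D m = 0"
      unfolding D_def using fs \<sigma>0
      by (simp add: fev.ev_sub fev.ev_z_left ev_Xop)
    then have "fps_nth (fev.ev \<sigma>' (flow (of_rat c) a) D m) 0 = 0" by simp
    then show ?thesis unfolding ev_fps_nth_0 by simp
  qed
  have "inj_on \<sigma> {..<r}" using root_inj[of r] by (auto simp: inj_on_def \<sigma>_def)
  moreover have "\<sigma> s \<noteq> 1" for s using root_nonzero[of r s] by (simp add: \<sigma>_def)
  ultimately have "D = nc0" using ev_faithful[OF assms(1) \<sigma>0 _ _ DN ev] by blast
  then show ?thesis by (simp add: D_def fun_eq_iff nc_apply)
qed

section \<open>Vanishing of the L-values\<close>

lemma Lsh_eq_lext: "Lsh r = cev.lext (Lsh_word r)"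
  by (rule ext) (simp add: Lsh_def cev.lext_def)

text \<open>For a single word the transforms are truncated L-values by \<open>bdiff_nest\<close> and
  \<open>Lsh_trunc_eq\<close>, so the limit in \<open>conv_word_rate\<close> must be
  \<open>Lsh_word\<close>. Linearity does the rest.\<close>

lemma bdiff_ev_rate:
  assumes "T \<in> spanned (validC r)"
  defines "v \<equiv> cev.ev (\<lambda>s. 1 - root r s) (\<lambda>m. 1 / of_nat m)"
  shows "\<exists>C. \<forall>j. norm (bdiff (v T) j 0 - Lsh r T) \<le> C / sqrt (Suc j)"
  using assms(1)
proof (induction T rule: spanned_induct)
  case zero
  have "bdiff (v nc0) j 0 = 0" for j
    using bdiff_cmult[of 0 "\<lambda>_. 0::complex" j 0] by (simp add: v_def cev.ev_nc0[abs_def])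
  then show ?case by (intro exI[of _ 0]) (simp add: Lsh_eq_lext)
next
  case (add T w k)
  obtain C where C: "\<And>j. norm (bdiff (v T) j 0 - Lsh r T) \<le> C / sqrt (Suc j)" using add.IH by blast
  have w: "conv_word w" "w \<noteq> []" "\<forall>a\<in>set w. valid_letter r a" "ends_Y w"
    using add.hyps(1) validC_validY[OF add.hyps(1)] by (auto simp: validC_iff valid_word_def validY_def)
  obtain L C' where L: "\<And>j. norm ((\<Sum>k\<le>j. ell r w k) - L) \<le> C' / sqrt (Suc j)"
    using conv_word_rate[OF w(1-3)] by blast
  have "(\<lambda>j. C' / sqrt (Suc j)) \<longlonglongrightarrow> 0" by real_asymp
  then have "(\<lambda>j. (\<Sum>k\<le>j. ell r w k) - L) \<longlonglongrightarrow> 0"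
    by (rule Lim_null_comparison[OF always_eventually[OF allI[OF L]]])
  then have "(\<lambda>j. \<Sum>k\<le>j. ell r w k) \<longlonglongrightarrow> L" by (simp add: LIM_zero_iff)
  then have "(\<lambda>j. Lsh_trunc r w (Suc j)) \<longlonglongrightarrow> L"
    using w by (simp add: Lsh_trunc_eq lessThan_Suc_atMost)
  then have "Lsh_trunc r w \<longlonglongrightarrow> L" by (rule LIMSEQ_imp_Suc)
  then have Lw: "Lsh_word r w = L" unfolding Lsh_word_def by (rule limI)
  have fs: "fs T" by (rule spanned_fs[OF add.hyps(2)])
  have "v (T \<oplus> k \<cdot> wd w) = (\<lambda>m. v T m + of_rat k * v (wd w) m)"
    using fs by (auto simp: v_def cev.ev_add cev.ev_smult)
  then have "bdiff (v (T \<oplus> k \<cdot> wd w)) j 0 = bdiff (v T) j 0 + of_rat k * (\<Sum>l\<le>j. ell r w l)" for j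
    using bdiff_nest[of w r j] w(4) by (simp add: bdiff_add bdiff_cmult v_def cev.ev_wd[abs_def])
  moreover have "Lsh r (T \<oplus> k \<cdot> wd w) = Lsh r T + of_rat k * L"
    using fs by (simp add: Lsh_eq_lext cev.lext_add cev.lext_smult Lw)
  ultimately have "bdiff (v (T \<oplus> k \<cdot> wd w)) j 0 - Lsh r (T \<oplus> k \<cdot> wd w) =
      (bdiff (v T) j 0 - Lsh r T) + of_rat k * ((\<Sum>l\<le>j. ell r w l) - L)" for j
    by (simp add: algebra_simps)
  then have "norm (bdiff (v (T \<oplus> k \<cdot> wd w)) j 0 - Lsh r (T \<oplus> k \<cdot> wd w)) \<le>
      (C + norm (of_rat k :: complex) * C') / sqrt (Suc j)" for j
    using norm_triangle_ineq[of "bdiff (v T) j 0 - Lsh r T" "of_rat k * ((\<Sum>l\<le>j. ell r w l) - L)"]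
      C[of j] mult_left_mono[OF L[of j], of "norm (of_rat k :: complex)"]
    by (simp add: norm_mult add_divide_distrib)
  then show ?case by blast
qed

text \<open>The transforms of the evaluation of \<open>Xop c n P\<close> tend to its L-value,
  because it is again spanned by convergent words, and to 0, because it is the evaluation of
  \<open>P\<close> times a null multiplier.\<close>

lemma Lsh_Xop:
  assumes "r > 0" "P \<in> spanned (validC r)"
  shows "Lsh r (Xop c n P) = 0"
proof -
  define \<sigma> where "\<sigma> s = 1 - root r s" for s
  define a where "a m = 1 / complex_of_nat m" for m
  define v where "v = cev.ev \<sigma> a"
  define T where "T = Xop c n P"
  have T: "T \<in> spanned (validC r)"
    unfolding T_def using assms Xop_left_z by (intro Xop_spanned_validC) auto
  have a0: "a 0 = 0" and \<sigma>0: "\<sigma> 0 = 0" by (simp_all add: a_def \<sigma>_def root_def)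
  interpret harmonic_flow c \<sigma> "flow (of_rat c) a"
    using \<sigma>0 a0 by (rule harmonic_flow_flow)
  define q where "q m = fps_nth ((fps_deriv ^^ n) (- gsum 1 (flow (of_rat c) a) m)) 0" for m
  have q: "null_multiplier q"
    unfolding q_def by (rule null_multiplier_deriv_power) (simp add: a_def)
  have vT: "v T = (\<lambda>m. v P m * q m)"
  proof (rule ext)
    fix m
    have "fps_nth (fev.ev \<sigma>' (flow (of_rat c) a) T m) 0 = q m * v P m"
      unfolding T_def ev_Xop[OF spanned_fs[OF assms(2)]] q_def v_def
      by (simp add: ev_fps_nth_0)
    then show "v T m = v P m * q m" by (simp add: ev_fps_nth_0 v_def mult.commute)
  qed
  have v: "v = cev.ev (\<lambda>s. 1 - root r s) (\<lambda>m. 1 / of_nat m)"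
    by (simp add: v_def \<sigma>_def[abs_def] a_def[abs_def])
  obtain B where B: "\<And>j. norm (bdiff (v P) j 0 - Lsh r P) \<le> B / sqrt (Suc j)"
    using bdiff_ev_rate[OF assms(2)] unfolding v by blast
  have 1: "(\<lambda>M. bdiff (v T) M 0) \<longlonglongrightarrow> 0"
    unfolding vT by (rule null_multiplier_tendsto_0[OF q B])
  obtain B' where B': "\<And>j. norm (bdiff (v T) j 0 - Lsh r T) \<le> B' / sqrt (Suc j)"
    using bdiff_ev_rate[OF T] unfolding v by blast
  have "(\<lambda>j. B' / sqrt (Suc j)) \<longlonglongrightarrow> 0" by real_asymp
  then have "(\<lambda>j. bdiff (v T) j 0 - Lsh r T) \<longlonglongrightarrow> 0"
    by (rule Lim_null_comparison[OF always_eventually[OF allI[OF B']]])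
  then have "(\<lambda>j. bdiff (v T) j 0) \<longlonglongrightarrow> Lsh r T" by (simp add: LIM_zero_iff)
  then show ?thesis using 1 LIMSEQ_unique unfolding T_def by blast
qed

lemma Xop_Nil: "Xop c n (wd []) = nc0"
proof (induction n)
  case 0
  show ?case by (simp add: Xop_0 d1_Nil)
next
  case (Suc n)
  have "thetahat c (wd []) = nc0" by (simp add: thetahat_def)
  then show ?case
    unfolding Xop_Suc Suc linop_nc0[OF linop_thetahat]
    by (simp add: linop_nc0[OF linop_Xop] ncsub_def)
qed

theorem theorem4p14:
  fixes r n :: nat and c :: rat and P :: nc
  assumes "r > 0" and "n \<ge> 1" and "P \<in> A0 r"
  shows "dhat c n P \<in> A0 r \<and> Lsh r (dhat c n P) = 0"
proof -
  \<comment> \<open>The constant term is split off, since \<open>validC\<close> excludes the empty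
    word; \<open>Xop\<close> annihilates it by \<open>Xop_Nil\<close>.\<close>
  define P' where "P' = P([] := 0)"
  have P: "P = P' \<oplus> P [] \<cdot> wd []" by (auto simp: P'_def fun_eq_iff nc_apply wd_def)
  have "supp P' \<subseteq> supp P - {[]}" by (auto simp: P'_def supp_def)
  then have P': "P' \<in> spanned (validC r)"
    using assms(3) finite_subset[of "supp P'" "supp P"]
    by (auto simp: A0_def A_def spanned_def validC_iff valid_word_def)
  define X' where "X' = Xop c (n - 1) P'"
  have X': "X' \<in> spanned (validC r)"
    unfolding X'_def using assms(1) P' Xop_left_z by (intro Xop_spanned_validC) auto
  have "Xop c (n - 1) P = X' \<oplus> P [] \<cdot> nc0"
    unfolding X'_def Xop_Nil[of c "n - 1", symmetric] using spanned_fs[OF P']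
    by (subst P) (simp add: linop_add[OF linop_Xop] linop_smult[OF linop_Xop])
  also have "\<dots> = X'" by (simp add: fun_eq_iff nc_apply)
  finally have d: "dhat c n P = (1 / of_nat (fact (n - 1))) \<cdot> X'"
    by (simp add: dhat_def Xop_def)
  have "dhat c n P \<in> spanned (validC r)" unfolding d using X' by simp
  then have "dhat c n P \<in> A0 r"
    by (auto simp: A0_def A_def spanned_def validC_iff valid_word_def)
  moreover have "Lsh r (dhat c n P) = 0"
    unfolding d using spanned_fs[OF X'] Lsh_Xop[OF assms(1) P', of c "n - 1"]
    by (simp add: Lsh_eq_lext cev.lext_smult X'_def)
  ultimately show ?thesis ..
qed

end
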